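(* Let $X$ be an infinite dimensional Banach lattice. Then $X_L$ is a rearrangement invariant Banach sequence space and $X_U$ is a Banach sequence lattice. Moreover, if $\ell_\infty$ is not finitely lattice representable in $X$, then $X_U$ is also a rearrangement invariant Banach sequence space.
   Context: All Banach lattices are real. For a Banach lattice $X$ and $n\in\mathbb N$, $\mathfrak B_n(X)$ is the set of $n$-tuples $(x_1,\dots,x_n)$ of pairwise disjoint ($|x_i|\wedge|x_j|=0$, $i\ne j$) elements of norm $1$. For $a\in\mathbb R^n$: $\|a\|_{X_U(n)}:=\sup\{\|\sum_{i=1}^n a_ix_i\|_X:(x_i)\in\mathfrak B_n(X)\}$; $\Phi_n(a):=\inf\{\|\sum_{i=1}^n a_ix_i\|_X:(x_i)\in\mathfrak B_n(X)\}$; $\|a\|_{X_L(n)}:=\inf\{\sum_{k\in F}\Phi_n(a^k): F\text{ finite}, a^k\in\mathbb R^n, a=\sum_{k\in F}a^k\}$. $X_U$ (resp. $X_L$) is the space of real sequences $a$ with $\|a\|_{X_U}:=\sup_n\|(a_i)_{i=1}^n\|_{X_U(n)}<\infty$ (resp. $\|a\|_{X_L}:=\sup_n\|(a_i)_{i=1}^n\|_{X_L(n)}<\infty$). A Banach sequence lattice is a complete normed space $E$ of real sequences such that $a\in E$, $|b_i|\le|a_i|$ for all $i$ imply $b\in E$, $\|b\|_E\le\|a\|_E$. It is rearrangement invariant if $a\in E$ and $\#\{i:|b_i|>t\}\le\#\{i:|a_i|>t\}$ for all $t>0$ imply $b\in E$ and $\|b\|_E\le\|a\|_E$. $\ell_p$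 ($1\le p\le\infty$) is finitely lattice representable in $X$ if for every $n$ and $\varepsilon>0$ there exist pairwise disjoint $x_1,\dots,x_n\in X$ with $\|a\|_{\ell_p^n}\le\|\sum a_ix_i\|_X\le(1+\varepsilon)\|a\|_{\ell_p^n}$ for all $a\in\mathbb R^n$. *)

theory Defs
  imports "HOL-Analysis.Analysis"
begin

text \<open>Banach lattices are modelled as types of class banach + ordered_real_vector + lattice
 (a real Riesz space order compatible with the vector structure) satisfying the lattice norm
 condition below.\<close>

definition labs :: "'a::{ordered_real_vector, lattice} \<Rightarrow> 'a" where
  "labs x = sup x (- x)"

definition banach_lattice_norm :: "'a::{banach, ordered_real_vector, lattice} itself \<Rightarrow> bool" where
  "banach_lattice_norm _ \<longleftrightarrow> (\<forall>x y::'a. labs x \<le> labs y \<longrightarrow> norm x \<le> norm y)"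

definition infinite_dimensional :: "'a::real_vector itself \<Rightarrow> bool" where
  "infinite_dimensional _ \<longleftrightarrow> \<not> (\<exists>B::'a set. finite B \<and> span B = UNIV)"

definition ldisjoint :: "'a::{ordered_real_vector, lattice} \<Rightarrow> 'a \<Rightarrow> bool" where
  "ldisjoint x y \<longleftrightarrow> inf (labs x) (labs y) = 0"

definition Btuples :: "nat \<Rightarrow> (nat \<Rightarrow> 'a::{banach, ordered_real_vector, lattice}) set" where
  "Btuples n = {x. (\<forall>i<n. norm (x i) = 1) \<and> (\<forall>i<n. \<forall>j<n. i \<noteq> j \<longrightarrow> ldisjoint (x i) (x j))}"

definition XU_n :: "'a::{banach, ordered_real_vector, lattice} itself \<Rightarrow> nat \<Rightarrow> (nat \<Rightarrow> real) \<Rightarrow> real" where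
  "XU_n _ n a = (SUP x\<in>(Btuples n :: (nat \<Rightarrow> 'a) set). norm (\<Sum>i<n. a i *\<^sub>R x i))"

definition Phi_n :: "'a::{banach, ordered_real_vector, lattice} itself \<Rightarrow> nat \<Rightarrow> (nat \<Rightarrow> real) \<Rightarrow> real" where
  "Phi_n _ n a = (INF x\<in>(Btuples n :: (nat \<Rightarrow> 'a) set). norm (\<Sum>i<n. a i *\<^sub>R x i))"

definition XL_n :: "'a::{banach, ordered_real_vector, lattice} itself \<Rightarrow> nat \<Rightarrow> (nat \<Rightarrow> real) \<Rightarrow> real" where
  "XL_n T n a = Inf {(\<Sum>k\<in>F. Phi_n T n (A k)) | F (A :: nat \<Rightarrow> nat \<Rightarrow> real).
      finite F \<and> (\<forall>i<n. a i = (\<Sum>k\<in>F. A k i))}"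

definition XU_set :: "'a::{banach, ordered_real_vector, lattice} itself \<Rightarrow> (nat \<Rightarrow> real) set" where
  "XU_set T = {a. bdd_above (range (\<lambda>n. XU_n T n a))}"

definition XU_norm :: "'a::{banach, ordered_real_vector, lattice} itself \<Rightarrow> (nat \<Rightarrow> real) \<Rightarrow> real" where
  "XU_norm T a = (SUP n. XU_n T n a)"

definition XL_set :: "'a::{banach, ordered_real_vector, lattice} itself \<Rightarrow> (nat \<Rightarrow> real) set" where
  "XL_set T = {a. bdd_above (range (\<lambda>n. XL_n T n a))}"

definition XL_norm :: "'a::{banach, ordered_real_vector, lattice} itself \<Rightarrow> (nat \<Rightarrow> real) \<Rightarrow> real" where
  "XL_norm T a = (SUP n. XL_n T n a)"

definition banach_seq_lattice :: "(nat \<Rightarrow> real) set \<Rightarrow> ((nat \<Rightarrow> real) \<Rightarrow> real) \<Rightarrow> bool" where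
  "banach_seq_lattice E N \<longleftrightarrow>
     (\<lambda>i. 0) \<in> E \<and>
     (\<forall>a\<in>E. \<forall>b\<in>E. (\<lambda>i. a i + b i) \<in> E) \<and>
     (\<forall>a\<in>E. \<forall>c::real. (\<lambda>i. c * a i) \<in> E) \<and>
     (\<forall>a\<in>E. 0 \<le> N a) \<and>
     (\<forall>a\<in>E. N a = 0 \<longleftrightarrow> a = (\<lambda>i. 0)) \<and>
     (\<forall>a\<in>E. \<forall>c::real. N (\<lambda>i. c * a i) = \<bar>c\<bar> * N a) \<and>
     (\<forall>a\<in>E. \<forall>b\<in>E. N (\<lambda>i. a i + b i) \<le> N a + N b) \<and>
     (\<forall>f::nat \<Rightarrow> nat \<Rightarrow> real. (\<forall>m. f m \<in> E) \<longrightarrow>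
        (\<forall>e>0. \<exists>M. \<forall>m\<ge>M. \<forall>k\<ge>M. N (\<lambda>i. f m i - f k i) < e) \<longrightarrow>
        (\<exists>L\<in>E. \<forall>e>0. \<exists>M. \<forall>m\<ge>M. N (\<lambda>i. f m i - L i) < e)) \<and>
     (\<forall>a\<in>E. \<forall>b. (\<forall>i. \<bar>b i\<bar> \<le> \<bar>a i\<bar>) \<longrightarrow> b \<in> E \<and> N b \<le> N a)"

text \<open>Cardinality comparison of subsets of nat allowing infinite sets:
 \<open>#B \<le> #A\<close> (as cardinals).\<close>
definition card_le :: "nat set \<Rightarrow> nat set \<Rightarrow> bool" where
  "card_le B A \<longleftrightarrow> (finite A \<longrightarrow> finite B \<and> card B \<le> card A)"

definition rearrangement_invariant :: "(nat \<Rightarrow> real) set \<Rightarrow> ((nat \<Rightarrow> real) \<Rightarrow> real) \<Rightarrow> bool" where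
  "rearrangement_invariant E N \<longleftrightarrow> banach_seq_lattice E N \<and>
     (\<forall>a\<in>E. \<forall>b. (\<forall>t>0. card_le {i. \<bar>b i\<bar> > t} {i. \<bar>a i\<bar> > t}) \<longrightarrow> b \<in> E \<and> N b \<le> N a)"

definition linf_norm :: "nat \<Rightarrow> (nat \<Rightarrow> real) \<Rightarrow> real" where
  "linf_norm n a = (if n = 0 then 0 else Max ((\<lambda>i. \<bar>a i\<bar>) ` {..<n}))"

definition linf_flr :: "'a::{banach, ordered_real_vector, lattice} itself \<Rightarrow> bool" where
  "linf_flr _ \<longleftrightarrow> (\<forall>n. \<forall>e>0. \<exists>x::nat \<Rightarrow> 'a.
      (\<forall>i<n. \<forall>j<n. i \<noteq> j \<longrightarrow> ldisjoint (x i) (x j)) \<and>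
      (\<forall>a. linf_norm n a \<le> norm (\<Sum>i<n. a i *\<^sub>R x i) \<and>
            norm (\<Sum>i<n. a i *\<^sub>R x i) \<le> (1 + e) * linf_norm n a))"

end

theory Submission
  imports Defs
begin

text \<open>Both sequence spaces are given by suprema of lattice norms on the spaces \<open>\<real>\<^sup>n\<close> which dominate
 each coordinate, and every such supremum is a Banach sequence lattice. Rearrangement invariance
 follows once the norm on \<open>\<real>\<^sup>n\<close> is at most the norm on \<open>\<real>\<^sup>m\<close> under every injection of the coordinates.
 For \<open>X\<^sub>L\<close> this holds because subfamilies of normalized disjoint families are such families. For
 \<open>X\<^sub>U\<close> a disjoint family has to be enlarged at arbitrarily small cost. If no disjoint direction is
 left, many disjoint elements lie below one member \<open>x\<close> of the family. As \<open>\<ell>\<^sub>\<infinity>\<close> is not finitely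
 lattice representable, one of the corresponding pieces of \<open>x\<close> is small in norm, and cutting it out
 makes room for a new member.\<close>

section \<open>Riesz spaces\<close>

text \<open>An infimum over long families only has to be compared with shorter ones, which are
  always at hand; a supremum over short families has to be compared with longer ones, and these may
  fail to exist, for instance when a member is a weak unit. The way out is the identity behind the
  cut: for positive \<open>z\<close> and a large \<open>M\<close>, the positive and negative parts
  of \<open>x - M z\<close> are disjoint, the positive part is \<open>x\<close> without the piece
  \<open>inf x (M z)\<close>, and the negative part serves as the new member. For a single
  \<open>z\<close> nothing bounds the removed piece. Many disjoint \<open>z\<close> give disjoint
  pieces whose sum stays below \<open>x\<close>; if all of them had norm above a fixed
  \<open>\<eta>\<close>, they would span a copy of l_infty up to the constant
  \<open>1 / \<eta>\<close>. Absence of almost isometric copies excludes even this, because blocks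
  of such a system improve the constant (James). Infinite dimension provides the many disjoint
  \<open>z\<close>: a disjoint system of greatest possible length would consist of atoms spanning
  the space.\<close>

lemma inf_add_right: "inf (a + c) (b + c) = inf a b + (c :: 'a::{ordered_ab_group_add, lattice})"
proof (rule antisym)
  have "inf (a + c) (b + c) - c \<le> inf a b"
    by (rule le_infI) (simp_all add: diff_le_eq)
  then show "inf (a + c) (b + c) \<le> inf a b + c"
    by (simp only: diff_le_eq)
qed (simp add: add_right_mono)

lemma sup_add_right: "sup (a + c) (b + c) = sup a b + (c :: 'a::{ordered_ab_group_add, lattice})"
proof (rule antisym)
  have "sup a b \<le> sup (a + c) (b + c) - c"
    by (rule le_supI) (simp_all add: le_diff_eq)
  then show "sup a b + c \<le> sup (a + c) (b + c)"
    by (simp only: le_diff_eq)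
qed (simp add: add_right_mono)

lemma inf_plus_sup: "inf a b + sup a b = a + (b :: 'a::{ordered_ab_group_add, lattice})"
proof (rule antisym)
  have "a + inf a b \<le> a + b" "b + inf a b \<le> b + a"
    by (intro add_left_mono inf_le1 inf_le2)+
  then have "sup a b \<le> a + b - inf a b"
    by (intro le_supI) (simp_all add: le_diff_eq add.commute)
  then have "sup a b + inf a b \<le> a + b"
    by (simp only: le_diff_eq)
  then show "inf a b + sup a b \<le> a + b"
    by (subst add.commute)
  have "a + b \<le> a + sup a b" "b + a \<le> b + sup a b"
    by (intro add_left_mono sup_ge1 sup_ge2)+
  then have "a + b - sup a b \<le> inf a b"
    by (intro le_infI) (simp_all add: diff_le_eq add.commute)
  then show "a + b \<le> inf a b + sup a b"
    by (simp only: diff_le_eq)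
qed

text \<open>With \<open>w\<close> the overlap, \<open>sup x 0 - w\<close> still dominates both
  \<open>x\<close> and \<open>0\<close>, hence \<open>sup x 0\<close>. Splitting a difference in
  this way is the source of disjoint elements, both for atoms and for cutting a member of a
  family.\<close>

lemma inf_pos_neg_part: "inf (sup x 0) (sup (- x) 0) = (0 :: 'a::{ordered_ab_group_add, lattice})"
proof (rule antisym)
  let ?w = "inf (sup x 0) (sup (- x) 0)"
  have "sup (- x) 0 = sup x 0 - x"
    using sup_add_right[of x "- x" 0] by (simp add: sup_commute)
  then have "?w \<le> sup x 0 - x"
    by (metis inf_le2)
  then have "x \<le> sup x 0 - ?w"
    by (simp add: le_diff_eq add.commute)
  moreover have "0 \<le> sup x 0 - ?w"
    by simp
  ultimately have "sup x 0 \<le> sup x 0 - ?w"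
    by (rule sup_least)
  then show "?w \<le> 0"
    by (metis add.right_neutral add_le_cancel_left le_diff_eq)
qed simp

lemma inf_add_le:
  fixes x y z :: "'a::{ordered_ab_group_add, lattice}"
  assumes "0 \<le> x" "0 \<le> y" "0 \<le> z"
  shows "inf x (y + z) \<le> inf x y + inf x z"
proof -
  have "inf x (y + z) \<le> inf (x + z) (y + z)"
    using assms by (meson add_increasing2 inf.cobounded1 inf.cobounded2 inf.orderI le_inf_iff
        order.refl order_trans)
  then have "inf x (y + z) - inf x y \<le> z"
    by (simp add: inf_add_right diff_le_eq add.commute)
  moreover have "inf x (y + z) - inf x y \<le> x"
    using assms by (simp add: diff_le_eq add_increasing2 le_infI1)
  ultimately have "inf x (y + z) - inf x y \<le> inf x z"
    by (rule le_infI[rotated])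
  then show ?thesis
    by (simp only: diff_le_eq add.commute)
qed

lemma inf_add_eq_0:
  fixes x y z :: "'a::{ordered_ab_group_add, lattice}"
  assumes "0 \<le> x" "0 \<le> y" "0 \<le> z" "inf x y = 0" "inf x z = 0"
  shows "inf x (y + z) = 0"
  using inf_add_le[OF assms(1-3)] assms by (intro antisym) simp_all

lemma inf_eq_0_mono:
  fixes x y x' y' :: "'a::{ordered_ab_group_add, lattice}"
  assumes "inf x y = 0" "0 \<le> x'" "x' \<le> x" "0 \<le> y'" "y' \<le> y"
  shows "inf x' y' = 0"
  using inf_mono[OF assms(3,5)] assms by (intro antisym) auto

text \<open>Scaling by one positive factor is an order automorphism and keeps a zero infimum.
  Unequal coefficients are raised to the common bound \<open>m\<close>, and the smaller multiples
  are disjoint by monotonicity.\<close>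

lemma inf_scaleR_eq_0:
  fixes x y :: "'a::{ordered_real_vector, lattice}"
  assumes "inf x y = 0" "0 \<le> c" "0 \<le> d"
  shows "inf (c *\<^sub>R x) (d *\<^sub>R y) = 0"
proof -
  have xy: "0 \<le> x" "0 \<le> y"
    using assms(1) by (metis inf_le1, metis inf_le2)
  define m where "m = max 1 (max c d)"
  have m: "m > 0" "c \<le> m" "d \<le> m"
    by (auto simp: m_def)
  have "inf (m *\<^sub>R x) (m *\<^sub>R y) = 0"
  proof (rule antisym)
    have "(1 / m) *\<^sub>R inf (m *\<^sub>R x) (m *\<^sub>R y) \<le> (1 / m) *\<^sub>R (m *\<^sub>R x)"
      using m by (intro scaleR_left_mono) auto
    moreover have "(1 / m) *\<^sub>R inf (m *\<^sub>R x) (m *\<^sub>R y) \<le> (1 / m) *\<^sub>R (m *\<^sub>R y)"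
      using m by (intro scaleR_left_mono) auto
    ultimately have "(1 / m) *\<^sub>R inf (m *\<^sub>R x) (m *\<^sub>R y) \<le> 0"
      using m assms(1) by (metis divide_self_if le_inf_iff less_irrefl mult.left_neutral
          scaleR_one scaleR_scaleR times_divide_eq_left)
    then have "m *\<^sub>R ((1 / m) *\<^sub>R inf (m *\<^sub>R x) (m *\<^sub>R y)) \<le> m *\<^sub>R 0"
      using m by (intro scaleR_left_mono) auto
    then show "inf (m *\<^sub>R x) (m *\<^sub>R y) \<le> 0"
      using m by simp
  qed (use m xy in \<open>simp add: scaleR_nonneg_nonneg\<close>)
  then show ?thesis
    by (rule inf_eq_0_mono)
      (intro scaleR_right_mono scaleR_nonneg_nonneg m xy assms)+
qed

section \<open>Modulus and disjointness\<close>

lemma labs_ge: "x \<le> labs x" "- x \<le> labs x"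
  by (simp_all add: labs_def)

lemma labs_nonneg [simp]: "0 \<le> labs x"
proof -
  have "0 \<le> (1/2) *\<^sub>R (labs x + labs x)"
    using add_mono[OF labs_ge(1,2), of x x] by (intro scaleR_nonneg_nonneg) auto
  then show ?thesis
    by (simp flip: scaleR_add_left scaleR_right_distrib add: scaleR_2[symmetric])
qed

lemma labs_le_iff: "labs x \<le> y \<longleftrightarrow> x \<le> y \<and> - x \<le> y"
  by (simp add: labs_def)

lemma labs_of_nonneg: "0 \<le> x \<Longrightarrow> labs x = x"
  by (rule antisym) (auto simp: labs_le_iff labs_ge order_trans[of "- x" 0 x])

lemma labs_zero [simp]: "labs 0 = 0"
  by (simp add: labs_of_nonneg)

lemma labs_minus [simp]: "labs (- x) = labs x"
  by (simp add: labs_def sup_commute)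

lemma labs_triangle: "labs (x + y) \<le> labs x + labs y"
  using add_mono[OF labs_ge(1)[of x] labs_ge(1)[of y]] add_mono[OF labs_ge(2)[of x] labs_ge(2)[of y]]
  by (simp add: labs_le_iff)

lemma labs_sum: "labs (\<Sum>i\<in>I. f i) \<le> (\<Sum>i\<in>I. labs (f i))"
proof (induction I rule: infinite_finite_induct)
  case (insert i I)
  then show ?case
    by (auto intro: order_trans[OF labs_triangle] add_left_mono)
qed auto

lemma labs_scaleR: "labs (c *\<^sub>R x) = \<bar>c\<bar> *\<^sub>R labs x"
proof -
  have le: "labs (c *\<^sub>R x) \<le> \<bar>c\<bar> *\<^sub>R labs x" for c x
  proof (cases "c \<ge> 0")
    case True
    then show ?thesis
      using scaleR_left_mono[OF labs_ge(1)[of x] True] scaleR_left_mono[OF labs_ge(2)[of x] True]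
      by (simp add: labs_le_iff)
  next
    case False
    then have c: "0 \<le> - c" by simp
    show ?thesis
      using scaleR_left_mono[OF labs_ge(1)[of x] c] scaleR_left_mono[OF labs_ge(2)[of x] c] False
      by (simp add: labs_le_iff)
  qed
  show ?thesis
  proof (cases "c = 0")
    case False
    have "\<bar>c\<bar> *\<^sub>R labs ((1/c) *\<^sub>R (c *\<^sub>R x)) \<le> \<bar>c\<bar> *\<^sub>R (\<bar>1/c\<bar> *\<^sub>R labs (c *\<^sub>R x))"
      by (intro scaleR_left_mono le) auto
    then have "\<bar>c\<bar> *\<^sub>R labs x \<le> labs (c *\<^sub>R x)"
      using False by simp
    then show ?thesis
      using le by (rule antisym[rotated])
  qed simp
qed

lemma ldisjoint_commute: "ldisjoint x y \<longleftrightarrow> ldisjoint y x"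
  by (simp add: ldisjoint_def inf_commute)

lemma ldisjoint_nonneg: "0 \<le> x \<Longrightarrow> 0 \<le> y \<Longrightarrow> ldisjoint x y \<longleftrightarrow> inf x y = 0"
  by (simp add: ldisjoint_def labs_of_nonneg)

lemma ldisjoint_mono:
  "ldisjoint x y \<Longrightarrow> labs x' \<le> labs x \<Longrightarrow> labs y' \<le> labs y \<Longrightarrow> ldisjoint x' y'"
  unfolding ldisjoint_def by (erule inf_eq_0_mono) auto

lemma ldisjoint_scaleR: "ldisjoint x y \<Longrightarrow> ldisjoint (c *\<^sub>R x) (d *\<^sub>R y)"
  unfolding ldisjoint_def labs_scaleR by (rule inf_scaleR_eq_0) auto

lemma ldisjoint_sum:
  assumes "\<And>i. i \<in> I \<Longrightarrow> ldisjoint x (f i)"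
  shows "ldisjoint x (\<Sum>i\<in>I. f i)"
proof -
  have "inf (labs x) (\<Sum>i\<in>I. labs (f i)) = 0"
    using assms
  proof (induction I rule: infinite_finite_induct)
    case (insert i I)
    then show ?case
      by (auto simp: ldisjoint_def intro!: inf_add_eq_0 sum_nonneg)
  qed (auto simp: inf_absorb2)
  then show ?thesis
    unfolding ldisjoint_def by (rule inf_eq_0_mono) (auto intro: labs_sum)
qed

text \<open>Writing \<open>x\<close> as \<open>(x + y) - y\<close> gives
  \<open>labs x \<le> labs (x + y) + labs y\<close>, and meeting with \<open>labs x\<close> removes
  the last term by disjointness. So \<open>labs (x + y)\<close> dominates the supremum of the two
  moduli, which for disjoint elements is their sum.\<close>

lemma labs_add_ldisjoint:
  assumes "ldisjoint x y"
  shows "labs (x + y) = labs x + labs y"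
proof (rule antisym[OF labs_triangle])
  have le: "labs x \<le> labs (x + y)" if d: "ldisjoint x y" for x y :: 'a
  proof -
    have "labs x = labs ((x + y) + (- y))"
      by simp
    also have "\<dots> \<le> labs (x + y) + labs y"
      using labs_triangle[of "x + y" "- y"] by simp
    finally have "labs x \<le> inf (labs x) (labs (x + y) + labs y)"
      by simp
    also have "\<dots> \<le> inf (labs x) (labs (x + y)) + inf (labs x) (labs y)"
      by (intro inf_add_le) auto
    also have "\<dots> \<le> labs (x + y)"
      using d by (simp add: ldisjoint_def)
    finally show ?thesis .
  qed
  have "sup (labs x) (labs y) \<le> labs (x + y)"
    using le[OF assms] le[of y x] assms by (simp add: ldisjoint_commute add.commute)
  then show "labs x + labs y \<le> labs (x + y)"
    using inf_plus_sup[of "labs x" "labs y"] assms by (simp add: ldisjoint_def del: sup.bounded_iff)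
qed

definition disjoint_on :: "'i set \<Rightarrow> ('i \<Rightarrow> 'a::{ordered_real_vector, lattice}) \<Rightarrow> bool" where
  "disjoint_on I x \<longleftrightarrow> (\<forall>i\<in>I. \<forall>j\<in>I. i \<noteq> j \<longrightarrow> ldisjoint (x i) (x j))"

lemma disjoint_on_subset: "disjoint_on I x \<Longrightarrow> J \<subseteq> I \<Longrightarrow> disjoint_on J x"
  unfolding disjoint_on_def by blast

lemma labs_sum_disjoint:
  assumes "finite I" "disjoint_on I x"
  shows "labs (\<Sum>i\<in>I. a i *\<^sub>R x i) = (\<Sum>i\<in>I. \<bar>a i\<bar> *\<^sub>R labs (x i))"
  using assms
proof (induction I)
  case (insert i I)
  have "ldisjoint (a i *\<^sub>R x i) (\<Sum>i\<in>I. a i *\<^sub>R x i)"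
    using insert by (intro ldisjoint_sum ldisjoint_scaleR) (auto simp: disjoint_on_def)
  moreover have "disjoint_on I x"
    using insert.prems by (rule disjoint_on_subset) auto
  ultimately show ?case
    using insert by (simp add: labs_add_ldisjoint labs_scaleR)
qed simp

text \<open>A sum of disjoint positive elements is their supremum. Hence disjoint pieces of one
  \<open>x\<close> never add up beyond \<open>x\<close>, whatever their number.\<close>

lemma sum_disjoint_le:
  assumes "finite I" "disjoint_on I w" "\<And>i. i \<in> I \<Longrightarrow> 0 \<le> w i" "\<And>i. i \<in> I \<Longrightarrow> w i \<le> x" "0 \<le> x"
  shows "(\<Sum>i\<in>I. w i) \<le> x"
  using assms
proof (induction I)
  case (insert i I)
  have "disjoint_on I w"
    using insert.prems(1) by (rule disjoint_on_subset) auto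
  then have le: "(\<Sum>i\<in>I. w i) \<le> x"
    using insert by auto
  have "ldisjoint (w i) (\<Sum>i\<in>I. w i)"
    using insert by (intro ldisjoint_sum) (auto simp: disjoint_on_def)
  then have "inf (w i) (\<Sum>i\<in>I. w i) = 0"
    using insert.prems by (subst (asm) ldisjoint_nonneg) (auto intro: sum_nonneg)
  then have "w i + (\<Sum>i\<in>I. w i) = sup (w i) (\<Sum>i\<in>I. w i)"
    using inf_plus_sup[of "w i" "\<Sum>i\<in>I. w i"] by simp
  then show ?case
    using insert le by simp
qed simp

section \<open>Banach lattices\<close>

lemma banach_lattice_norm_mono:
  "banach_lattice_norm TYPE('a::{banach, ordered_real_vector, lattice}) \<Longrightarrow> labs (x::'a) \<le> labs y
    \<Longrightarrow> norm x \<le> norm y"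
  by (simp add: banach_lattice_norm_def)

lemma norm_mono_nonneg:
  assumes "banach_lattice_norm TYPE('a::{banach, ordered_real_vector, lattice})"
    and "0 \<le> (x::'a)" "x \<le> y"
  shows "norm x \<le> norm y"
  using assms by (intro banach_lattice_norm_mono) (auto simp: labs_of_nonneg order_trans[of 0 x])

lemma norm_labs:
  assumes "banach_lattice_norm TYPE('a::{banach, ordered_real_vector, lattice})"
  shows "norm (labs (x::'a)) = norm x"
  by (intro antisym banach_lattice_norm_mono[OF assms]) (simp_all add: labs_of_nonneg)

text \<open>The modulus of a disjoint sum is the sum of the moduli, so norms can be compared term by
  term. Shrinking coefficients, shrinking vectors and dropping indices are all instances.\<close>

lemma norm_sum_disjoint_mono:
  fixes x y :: "'i \<Rightarrow> 'a::{banach, ordered_real_vector, lattice}"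
  assumes "banach_lattice_norm TYPE('a)" "finite J" "I \<subseteq> J" "disjoint_on I x" "disjoint_on J y"
    and "\<And>i. i \<in> I \<Longrightarrow> \<bar>b i\<bar> *\<^sub>R labs (x i) \<le> \<bar>a i\<bar> *\<^sub>R labs (y i)"
  shows "norm (\<Sum>i\<in>I. b i *\<^sub>R x i) \<le> norm (\<Sum>i\<in>J. a i *\<^sub>R y i)"
proof (rule banach_lattice_norm_mono[OF assms(1)])
  have "finite I"
    using assms finite_subset by blast
  then have "labs (\<Sum>i\<in>I. b i *\<^sub>R x i) = (\<Sum>i\<in>I. \<bar>b i\<bar> *\<^sub>R labs (x i))"
    using assms by (simp add: labs_sum_disjoint)
  also have "\<dots> \<le> (\<Sum>i\<in>I. \<bar>a i\<bar> *\<^sub>R labs (y i))"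
    using assms by (intro sum_mono)
  also have "\<dots> \<le> (\<Sum>i\<in>J. \<bar>a i\<bar> *\<^sub>R labs (y i))"
    using assms by (intro sum_mono2) (auto intro: scaleR_nonneg_nonneg)
  also have "\<dots> = labs (\<Sum>i\<in>J. a i *\<^sub>R y i)"
    using assms by (simp add: labs_sum_disjoint)
  finally show "labs (\<Sum>i\<in>I. b i *\<^sub>R x i) \<le> labs (\<Sum>i\<in>J. a i *\<^sub>R y i)" .
qed

text \<open>The Archimedean property, derived from the norm: the positive part of \<open>u\<close>
  lies below every \<open>e *\<^sub>R x\<close>, so its norm is zero.\<close>

lemma le_zero_if_le_scaleR:
  fixes u x :: "'a::{banach, ordered_real_vector, lattice}"
  assumes "banach_lattice_norm TYPE('a)" "\<And>e. 0 < e \<Longrightarrow> u \<le> e *\<^sub>R x" "0 \<le> x"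
  shows "u \<le> 0"
proof -
  have "norm (sup u 0) \<le> 0 + e" if "e > 0" for e
  proof -
    \<comment> \<open>The \<open>+ 1\<close> covers the case \<open>x = 0\<close>.\<close>
    have pos: "e / (norm x + 1) > 0"
      using that by (simp add: add_nonneg_pos)
    have "norm (sup u 0) \<le> norm ((e / (norm x + 1)) *\<^sub>R x)"
      using assms pos by (intro norm_mono_nonneg) (auto intro: scaleR_nonneg_nonneg)
    also have "\<dots> \<le> e"
    proof -
      have "norm x / (norm x + 1) \<le> 1"
        by (simp add: divide_le_eq_1 add_nonneg_pos)
      then show ?thesis
        using that mult_left_mono[of "norm x / (norm x + 1)" 1 e] by simp
    qed
    finally show ?thesis by simp
  qed
  then have "sup u 0 = 0"
    by (metis field_le_epsilon norm_le_zero_iff)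
  then show ?thesis
    by (metis sup.cobounded1)
qed

section \<open>Disjoint systems in infinite dimensional Banach lattices\<close>

text \<open>Take the largest multiple \<open>t *\<^sub>R x\<close> below \<open>u\<close>, and let
  \<open>w\<close> be the overlap of the remainder with the atom \<open>x\<close>. For small
  \<open>s > 0\<close> the positive and negative parts of \<open>w - s *\<^sub>R x\<close> are
  disjoint elements below \<open>x\<close>, so one vanishes. Either
  \<open>w \<le> s *\<^sub>R x\<close>, or \<open>s *\<^sub>R x\<close> fits into the remainder
  against the choice of \<open>t\<close>. Thus \<open>w\<close> is below every positive multiple of
  \<open>x\<close>.\<close>

lemma atom_decomposition:
  fixes x u :: "'a::{banach, ordered_real_vector, lattice}"
  assumes bl: "banach_lattice_norm TYPE('a)" and x: "0 \<le> x" "x \<noteq> 0" and u: "0 \<le> u"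
    and atom: "\<And>v w. 0 \<le> v \<Longrightarrow> v \<le> x \<Longrightarrow> 0 \<le> w \<Longrightarrow> w \<le> x \<Longrightarrow> inf v w = 0 \<Longrightarrow> v = 0 \<or> w = 0"
  shows "\<exists>t\<ge>0. t *\<^sub>R x \<le> u \<and> inf (u - t *\<^sub>R x) x = 0"
proof -
  define T where "T = {t. 0 \<le> t \<and> t *\<^sub>R x \<le> u}"
  define t where "t = Sup T"
  have T0: "0 \<in> T"
    using u by (simp add: T_def)
  have bdd: "bdd_above T"
  proof (rule bdd_aboveI[where M = "norm u / norm x"])
    fix s assume "s \<in> T"
    then have "norm (s *\<^sub>R x) \<le> norm u"
      using bl x by (intro norm_mono_nonneg) (auto simp: T_def intro: scaleR_nonneg_nonneg)
    then show "s \<le> norm u / norm x"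
      using x \<open>s \<in> T\<close> by (simp add: T_def field_simps)
  qed
  have t0: "0 \<le> t"
    unfolding t_def using T0 bdd by (rule cSup_upper)
  have "t *\<^sub>R x - u \<le> 0"
  proof (rule le_zero_if_le_scaleR[OF bl _ x(1)])
    fix e :: real assume "e > 0"
    then obtain s where s: "s \<in> T" "t - e < s"
      using less_cSup_iff[of T "t - e"] T0 bdd by (auto simp: t_def)
    have "t *\<^sub>R x \<le> (e + s) *\<^sub>R x"
      using s x by (intro scaleR_right_mono) auto
    also have "\<dots> \<le> e *\<^sub>R x + u"
      using s by (auto simp: T_def scaleR_left_distrib)
    finally show "t *\<^sub>R x - u \<le> e *\<^sub>R x"
      by (simp add: diff_le_eq)
  qed
  then have tx: "t *\<^sub>R x \<le> u"
    by simp
  define w where "w = inf (u - t *\<^sub>R x) x"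
  have w: "0 \<le> w" "w \<le> x" "w \<le> u - t *\<^sub>R x"
    using tx x by (auto simp: w_def)
  have "w \<le> 0"
  proof (rule le_zero_if_le_scaleR[OF bl _ x(1)])
    fix s :: real assume s: "s > 0"
    show "w \<le> s *\<^sub>R x"
    proof (cases "s \<le> 1")
      case False
      have "x = 1 *\<^sub>R x" by simp
      also have "\<dots> \<le> s *\<^sub>R x"
        using False x by (intro scaleR_right_mono) auto
      finally show ?thesis
        using w by simp
    next
      case True
      \<comment> \<open>The bound \<open>s \<le> 1\<close> puts the negative part of
        \<open>w - s *\<^sub>R x\<close> below \<open>x\<close>, as \<open>atom\<close>
        demands.\<close>
      have sx: "0 \<le> s *\<^sub>R x" "s *\<^sub>R x \<le> 1 *\<^sub>R x"
        using True s x by (auto intro: scaleR_nonneg_nonneg simp del: scaleR_one intro!: scaleR_right_mono)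
      have "sup (w - s *\<^sub>R x) 0 = 0 \<or> sup (- (w - s *\<^sub>R x)) 0 = 0"
      proof (rule atom)
        have "w - s *\<^sub>R x \<le> x - 0"
          using w sx by (intro diff_mono) auto
        then show "sup (w - s *\<^sub>R x) 0 \<le> x"
          using x by simp
        have "s *\<^sub>R x - w \<le> x - 0"
          using w sx by (intro diff_mono) auto
        then show "sup (- (w - s *\<^sub>R x)) 0 \<le> x"
          using x by simp
      qed (rule inf_pos_neg_part sup_ge2)+
      then show ?thesis
      proof
        assume "sup (w - s *\<^sub>R x) 0 = 0"
        then have "w - s *\<^sub>R x \<le> 0"
          by (metis sup.cobounded1)
        then show ?thesis by simp
      next
        assume "sup (- (w - s *\<^sub>R x)) 0 = 0"
        then have "- (w - s *\<^sub>R x) \<le> 0"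
          by (metis sup.cobounded1)
        then have "s *\<^sub>R x \<le> u - t *\<^sub>R x"
          using w by (auto intro: order_trans)
        then have "t + s \<in> T"
          using s t0 by (simp add: T_def scaleR_left_distrib le_diff_eq add.commute)
        then have "t + s \<le> t"
          unfolding t_def using bdd by (rule cSup_upper)
        then show ?thesis
          using s by simp
      qed
    qed
  qed
  then have "inf (u - t *\<^sub>R x) x = 0"
    using w(1) unfolding w_def by (rule antisym)
  then show ?thesis
    using t0 tx by auto
qed

text \<open>If the size of disjoint sets stopped at \<open>k\<close>, the members of a set of size
  \<open>k\<close> would be atoms, since two disjoint nonzero parts could replace a member. Removing
  multiples of these atoms from a positive \<open>u\<close> leaves an element disjoint from all of
  them, which vanishes by maximality. The positive cone, and with it the space, would lie in a
  finite dimensional span.\<close>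

lemma exists_disjoint_set:
  assumes bl: "banach_lattice_norm TYPE('a::{banach, ordered_real_vector, lattice})"
    and inf_dim: "infinite_dimensional TYPE('a)"
  shows "\<exists>S::'a set. finite S \<and> card S = n \<and> (\<forall>x\<in>S. 0 \<le> x \<and> x \<noteq> 0) \<and> disjoint_on S id"
proof (rule ccontr)
  define Q where "Q S \<longleftrightarrow> finite S \<and> (\<forall>x\<in>S. 0 \<le> x \<and> x \<noteq> 0) \<and> disjoint_on S id" for S :: "'a set"
  define P where "P n \<longleftrightarrow> (\<exists>S. Q S \<and> card S = n)" for n
  assume "\<not> ?thesis"
  then have "\<not> P n"
    by (auto simp: P_def Q_def)
  moreover have "P 0"
    unfolding P_def Q_def by (intro exI[of _ "{}"]) (auto simp: disjoint_on_def)
  ultimately obtain k where "P k" "\<not> P (Suc k)"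
    by (metis nat_induct)
  then obtain S where S: "Q S" "card S = k"
    by (auto simp: P_def)
  have max: "\<not> Q S'" if "card S' = Suc k" for S'
    using \<open>\<not> P (Suc k)\<close> that by (auto simp: P_def)
  have fin: "finite S" and pos: "\<And>x. x \<in> S \<Longrightarrow> 0 \<le> x \<and> x \<noteq> 0" and disj: "disjoint_on S id"
    using S by (auto simp: Q_def)
  have atom: "v = 0 \<or> w = 0"
    if x: "x \<in> S" and vw: "0 \<le> v" "v \<le> x" "0 \<le> w" "w \<le> x" "inf v w = 0" for x v w
  proof (rule ccontr)
    assume nz: "\<not> (v = 0 \<or> w = 0)"
    have new: "ldisjoint y z" if "y \<in> S - {x}" "0 \<le> z" "z \<le> x" for y z
    proof -
      have "ldisjoint y x"
        using that x disj by (auto simp: disjoint_on_def)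
      then show ?thesis
        by (rule ldisjoint_mono) (use that pos x in \<open>auto simp: labs_of_nonneg\<close>)
    qed
    have notin: "z \<notin> S - {x}" if "z \<noteq> 0" "0 \<le> z" "z \<le> x" for z
      using new[of z z] that by (auto simp: ldisjoint_nonneg)
    have "v \<noteq> w"
      using vw nz by auto
    then have "card (insert v (insert w (S - {x}))) = Suc (Suc (card (S - {x})))"
      using fin notin[of v] notin[of w] vw nz by simp
    then have "card (insert v (insert w (S - {x}))) = Suc k"
      using card_Suc_Diff1[OF fin x] S by simp
    moreover have "Q (insert v (insert w (S - {x})))"
      unfolding Q_def
    proof (intro conjI)
      show "disjoint_on (insert v (insert w (S - {x}))) id"
      proof -
        have "ldisjoint v w" "ldisjoint w v"
          using vw by (simp_all add: ldisjoint_nonneg inf_commute)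
        moreover have "ldisjoint y v" "ldisjoint v y" "ldisjoint y w" "ldisjoint w y"
          if "y \<in> S - {x}" for y
          using new[OF that, of v] new[OF that, of w] vw ldisjoint_commute by blast+
        moreover have "disjoint_on (S - {x}) id"
          using disj by (rule disjoint_on_subset) auto
        ultimately show ?thesis
          by (auto simp: disjoint_on_def)
      qed
    qed (use fin pos vw nz in auto)
    ultimately show False
      using max by blast
  qed
  \<comment> \<open>One atom is removed at a time. The remainder only decreases, so its disjointness
    from the atoms treated before persists.\<close>
  have reduce: "\<exists>v \<in> span S. 0 \<le> u - v \<and> v \<ge> 0 \<and> (\<forall>x\<in>S'. inf (u - v) x = 0)"
    if "0 \<le> u" "S' \<subseteq> S" for u S'
    using finite_subset[OF that(2) fin] that(2)
  proof (induction S')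
    case empty
    then show ?case
      using that by (auto intro!: bexI[of _ 0] span_zero)
  next
    case (insert x S')
    then obtain v where v: "v \<in> span S" "0 \<le> u - v" "v \<ge> 0" "\<forall>x\<in>S'. inf (u - v) x = 0"
      by auto
    have x: "x \<in> S" "0 \<le> x" "x \<noteq> 0"
      using insert pos by auto
    obtain t where t: "t \<ge> 0" "t *\<^sub>R x \<le> u - v" "inf (u - v - t *\<^sub>R x) x = 0"
      using atom_decomposition[OF bl x(2,3) v(2) atom[OF x(1)]] by blast
    have tx: "0 \<le> t *\<^sub>R x"
      using t x by (auto intro: scaleR_nonneg_nonneg)
    have "inf (u - (v + t *\<^sub>R x)) y = 0" if "y \<in> S'" for y
      by (rule inf_eq_0_mono[of "u - v" y])
        (use that v t insert.prems pos tx in \<open>auto simp: diff_diff_eq[symmetric] diff_le_eq le_add_same_cancel1\<close>)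
    then show ?case
      using v t x tx
      by (intro bexI[of _ "v + t *\<^sub>R x"]) (auto simp: diff_diff_eq[symmetric] span_add span_scale span_base)
  qed
  have pos_span: "u \<in> span S" if u: "0 \<le> u" for u
  proof -
    obtain v where v: "v \<in> span S" "0 \<le> u - v" "\<forall>x\<in>S. inf (u - v) x = 0"
      using reduce[OF u order.refl] by blast
    have "u - v = 0"
    proof (rule ccontr)
      assume nz: "u - v \<noteq> 0"
      then have "u - v \<notin> S"
        using v by auto
      then have "card (insert (u - v) S) = Suc k"
        using S fin by simp
      moreover have "Q (insert (u - v) S)"
        using S v nz by (auto simp: Q_def disjoint_on_def ldisjoint_nonneg inf_commute[of _ "u - v"])
      ultimately show False
        using max by blast
    qed
    then show ?thesis
      using v by simp
  qed
  have "x \<in> span S" for x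
  proof -
    have "x = labs x - (labs x - x)"
      by simp
    also have "\<dots> \<in> span S"
      by (intro span_diff pos_span) (auto simp: labs_ge)
    finally show ?thesis .
  qed
  then show False
    using inf_dim fin by (auto simp: infinite_dimensional_def)
qed

lemma exists_disjoint_family:
  assumes "banach_lattice_norm TYPE('a::{banach, ordered_real_vector, lattice})"
    and "infinite_dimensional TYPE('a)"
  shows "\<exists>y::nat \<Rightarrow> 'a. disjoint_on {..<n} y \<and> (\<forall>i<n. 0 \<le> y i \<and> y i \<noteq> 0)"
proof -
  obtain S :: "'a set" where S: "finite S" "card S = n" "\<forall>x\<in>S. 0 \<le> x \<and> x \<noteq> 0" "disjoint_on S id"
    using exists_disjoint_set[OF assms] by blast
  obtain y where y: "bij_betw y {0..<n} S"
    using ex_bij_betw_nat_finite[OF S(1)] S(2) by blast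
  have "y i \<in> S" if "i < n" for i
    using y that by (auto simp: bij_betw_def)
  moreover have "y i \<noteq> y j" if "i < n" "j < n" "i \<noteq> j" for i j
    using y that by (auto simp: bij_betw_def inj_on_def)
  ultimately show ?thesis
    using S by (intro exI[of _ y]) (auto simp: disjoint_on_def)
qed

section \<open>Sequence spaces from compatible norms on the spaces of finite sequences\<close>

text \<open>Each axiom concerns a single \<open>n\<close>. Completeness can therefore be settled for
  both spaces at once, before anything is known about the comparison of different lengths, which is
  the delicate point for \<open>XU_n\<close>.\<close>

locale finite_lattice_norms =
  fixes N :: "nat \<Rightarrow> (nat \<Rightarrow> real) \<Rightarrow> real"
  assumes scale: "N n (\<lambda>i. c * a i) = \<bar>c\<bar> * N n a"
    and triangle: "N n (\<lambda>i. a i + b i) \<le> N n a + N n b"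
    and mono: "(\<And>i. i < n \<Longrightarrow> \<bar>b i\<bar> \<le> \<bar>a i\<bar>) \<Longrightarrow> N n b \<le> N n a"
    and coord_le: "i < n \<Longrightarrow> \<bar>a i\<bar> \<le> N n a"
begin

definition space :: "(nat \<Rightarrow> real) set" where
  "space = {a. bdd_above (range (\<lambda>n. N n a))}"

definition norm_sup :: "(nat \<Rightarrow> real) \<Rightarrow> real" where
  "norm_sup a = (SUP n. N n a)"

lemma zero: "N n (\<lambda>i. 0) = 0"
  using scale[of n 0] by simp

lemma nonneg: "0 \<le> N n a"
  using mono[of n "\<lambda>i. 0" a] zero by simp

lemma le_norm_sup: "a \<in> space \<Longrightarrow> N n a \<le> norm_sup a"
  unfolding space_def norm_sup_def by (auto intro: cSUP_upper)

lemma norm_supI: "(\<And>n. N n a \<le> C) \<Longrightarrow> a \<in> space \<and> norm_sup a \<le> C"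
  unfolding space_def norm_sup_def
  by (intro conjI CollectI cSUP_least bdd_aboveI2[where M = C]) simp_all

lemma norm_sup_nonneg: "a \<in> space \<Longrightarrow> 0 \<le> norm_sup a"
  using le_norm_sup nonneg by (rule order_trans[rotated])

lemma coord_le_norm_sup: "a \<in> space \<Longrightarrow> \<bar>a i\<bar> \<le> norm_sup a"
  using coord_le[of i "Suc i" a] le_norm_sup[of a "Suc i"] by simp

lemma add_closed:
  assumes "a \<in> space" "b \<in> space"
  shows "(\<lambda>i. a i + b i) \<in> space \<and> norm_sup (\<lambda>i. a i + b i) \<le> norm_sup a + norm_sup b"
proof (rule norm_supI)
  fix n
  show "N n (\<lambda>i. a i + b i) \<le> norm_sup a + norm_sup b"
    using triangle[of n a b] le_norm_sup[OF assms(1), of n] le_norm_sup[OF assms(2), of n] by simp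
qed

lemma scale_closed:
  assumes "a \<in> space"
  shows "(\<lambda>i. c * a i) \<in> space \<and> norm_sup (\<lambda>i. c * a i) = \<bar>c\<bar> * norm_sup a"
proof -
  have le: "(\<lambda>i. c * a i) \<in> space \<and> norm_sup (\<lambda>i. c * a i) \<le> \<bar>c\<bar> * norm_sup a"
    if "a \<in> space" for c a
    using le_norm_sup[OF that] by (intro norm_supI) (simp add: scale mult_left_mono)
  have "\<bar>c\<bar> * norm_sup a \<le> norm_sup (\<lambda>i. c * a i)"
  proof (cases "c = 0")
    case True
    then show ?thesis
      using norm_sup_nonneg le[OF assms, of 0] by simp
  next
    case False
    have "norm_sup (\<lambda>i. (1 / c) * (c * a i)) \<le> \<bar>1 / c\<bar> * norm_sup (\<lambda>i. c * a i)"
      using le[of "\<lambda>i. c * a i" "1 / c"] le[OF assms, of c] by blast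
    then show ?thesis
      using False by (simp add: field_simps)
  qed
  then show ?thesis
    using le[OF assms] by (simp add: antisym)
qed

lemma mono_closed:
  assumes "a \<in> space" "\<And>i. \<bar>b i\<bar> \<le> \<bar>a i\<bar>"
  shows "b \<in> space \<and> norm_sup b \<le> norm_sup a"
proof (rule norm_supI)
  show "N n b \<le> norm_sup a" for n
    using mono[of n b a] assms(2) le_norm_sup[OF assms(1), of n] by force
qed

text \<open>The limit is taken coordinatewise, as \<open>coord_le_norm_sup\<close> permits. By
  \<open>mono\<close>, \<open>N n\<close> sees only the first \<open>n\<close> coordinates, so the
  Cauchy bound passes to the limit for each fixed \<open>n\<close>, with a threshold
  \<open>M\<close> independent of \<open>n\<close>.\<close>

lemma complete:
  fixes f :: "nat \<Rightarrow> nat \<Rightarrow> real"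
  assumes f: "\<And>m. f m \<in> space"
    and Cauchy: "\<And>e. 0 < e \<Longrightarrow> \<exists>M. \<forall>m\<ge>M. \<forall>k\<ge>M. norm_sup (\<lambda>i. f m i - f k i) < e"
  shows "\<exists>L\<in>space. \<forall>e>0. \<exists>M. \<forall>m\<ge>M. norm_sup (\<lambda>i. f m i - L i) < e"
proof -
  have diff: "(\<lambda>i. a i - b i) \<in> space" if "a \<in> space" "b \<in> space" for a b
    using add_closed[of a "\<lambda>i. -1 * b i"] scale_closed[of b "-1"] that by simp
  have "convergent (\<lambda>m. f m i)" for i
  proof (rule Cauchy_convergent, rule metric_CauchyI)
    fix e :: real assume "0 < e"
    then obtain M where M: "\<forall>m\<ge>M. \<forall>k\<ge>M. norm_sup (\<lambda>i. f m i - f k i) < e"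
      using Cauchy by blast
    have "dist (f m i) (f k i) < e" if "m \<ge> M" "k \<ge> M" for m k
    proof -
      have "dist (f m i) (f k i) \<le> norm_sup (\<lambda>i. f m i - f k i)"
        using coord_le_norm_sup[OF diff[OF f[of m] f[of k]], of i] by (simp add: dist_real_def)
      also have "\<dots> < e"
        using M that by blast
      finally show ?thesis .
    qed
    then show "\<exists>M. \<forall>m\<ge>M. \<forall>k\<ge>M. dist (f m i) (f k i) < e"
      by blast
  qed
  then obtain L where L: "(\<lambda>m. f m i) \<longlonglongrightarrow> L i" for i
    unfolding convergent_def by metis
  have lim: "\<exists>M. \<forall>m\<ge>M. (\<lambda>i. f m i - L i) \<in> space \<and> norm_sup (\<lambda>i. f m i - L i) \<le> e"
    if "0 < e" for e
  proof -
    obtain M where M: "\<forall>m\<ge>M. \<forall>k\<ge>M. norm_sup (\<lambda>i. f m i - f k i) < e"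
      using Cauchy \<open>0 < e\<close> by blast
    have "(\<lambda>i. f m i - L i) \<in> space \<and> norm_sup (\<lambda>i. f m i - L i) \<le> e" if "m \<ge> M" for m
    proof (rule norm_supI, rule field_le_epsilon)
      fix n and \<delta> :: real assume "0 < \<delta>"
      \<comment> \<open>Chosen so that the constant sequence \<open>\<eta>\<close> has norm at most
        \<open>\<delta>\<close>; the \<open>+ 1\<close> avoids a zero denominator, as would occur
        for \<open>n = 0\<close>.\<close>
      define \<eta> where "\<eta> = \<delta> / (N n (\<lambda>i. 1) + 1)"
      have \<eta>: "0 < \<eta>"
        using nonneg[of n "\<lambda>i. 1"] \<open>0 < \<delta>\<close> by (simp add: \<eta>_def)
      have "\<forall>\<^sub>F k in sequentially. \<forall>i\<in>{..<n}. dist (f k i) (L i) < \<eta>"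
        using L \<eta> by (intro eventually_ball_finite) (auto simp: tendsto_iff)
      then obtain K where K: "\<And>k i. k \<ge> K \<Longrightarrow> i < n \<Longrightarrow> \<bar>f k i - L i\<bar> < \<eta>"
        by (auto simp: eventually_sequentially dist_real_def)
      define k where "k = max K M"
      have "N n (\<lambda>i. f m i - L i) = N n (\<lambda>i. (f m i - f k i) + (f k i - L i))"
        by simp
      also have "\<dots> \<le> N n (\<lambda>i. f m i - f k i) + N n (\<lambda>i. f k i - L i)"
        by (rule triangle)
      also have "N n (\<lambda>i. f m i - f k i) \<le> e"
      proof -
        have "N n (\<lambda>i. f m i - f k i) \<le> norm_sup (\<lambda>i. f m i - f k i)"
          by (rule le_norm_sup[OF diff[OF f f]])
        also have "\<dots> < e"
          using M that by (simp add: k_def)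
        finally show ?thesis by simp
      qed
      also have "N n (\<lambda>i. f k i - L i) \<le> N n (\<lambda>i. \<eta> * 1)"
        using K[of k] \<eta> by (intro mono) (auto simp: k_def less_imp_le)
      also have "\<dots> = \<eta> * N n (\<lambda>i. 1)"
        using \<eta> by (subst scale) simp
      also have "\<dots> \<le> \<delta>"
        using nonneg[of n "\<lambda>i. 1"] \<open>0 < \<delta>\<close> by (simp add: \<eta>_def field_simps)
      finally show "N n (\<lambda>i. f m i - L i) \<le> e + \<delta>"
        by simp
    qed
    then show ?thesis by blast
  qed
  obtain m where m: "(\<lambda>i. f m i - L i) \<in> space"
    using lim[of 1] by auto
  have "L \<in> space"
    using diff[OF f m, of m] by simp
  moreover have "\<exists>M. \<forall>m\<ge>M. norm_sup (\<lambda>i. f m i - L i) < e" if "0 < e" for e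
    using lim[of "e / 2"] that by fastforce
  ultimately show ?thesis by blast
qed

lemma banach_seq_lattice_space: "banach_seq_lattice space norm_sup"
proof -
  have zero_mem: "(\<lambda>i. 0) \<in> space \<and> norm_sup (\<lambda>i. 0) \<le> 0"
    by (rule norm_supI) (simp add: zero)
  have "norm_sup a = 0 \<longleftrightarrow> a = (\<lambda>i. 0)" if "a \<in> space" for a
    using coord_le_norm_sup[OF that] zero_mem norm_sup_nonneg[of "\<lambda>i. 0"] by fastforce
  then show ?thesis
    unfolding banach_seq_lattice_def
    using zero_mem add_closed scale_closed norm_sup_nonneg mono_closed complete
    by (intro conjI) (assumption | blast)+
qed

end

text \<open>The factor \<open>\<theta> < 1\<close> cannot be dropped: \<open>b\<close> may take the value \<open>1\<close> while \<open>\<bar>a\<bar>\<close> increases to \<open>1\<close>.\<close>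

lemma exists_dominating_injection:
  fixes a b :: "nat \<Rightarrow> real"
  assumes "\<And>t. 0 < t \<Longrightarrow> card_le {i. \<bar>b i\<bar> > t} {i. \<bar>a i\<bar> > t}" "finite I" "0 < \<theta>" "\<theta> < 1"
  shows "\<exists>\<sigma>. inj_on \<sigma> I \<and> (\<forall>i\<in>I. \<theta> * \<bar>b i\<bar> \<le> \<bar>a (\<sigma> i)\<bar>)"
  using assms(2)
proof (induction rule: finite_ranking_induct[where f = "\<lambda>i. - \<bar>b i\<bar>"])
  \<comment> \<open>Indices are inserted by decreasing \<open>\<bar>b i\<bar>\<close>, so
    \<open>\<bar>b j\<bar>\<close> is the least value on \<open>insert j I\<close>, and all these
    indices lie in every level set of \<open>b\<close> with
    \<open>t < \<bar>b j\<bar>\<close>.\<close>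
  case (insert j I)
  then obtain \<sigma> where \<sigma>: "inj_on \<sigma> I" "\<forall>i\<in>I. \<theta> * \<bar>b i\<bar> \<le> \<bar>a (\<sigma> i)\<bar>"
    by blast
  show ?case
  proof (cases "j \<in> I")
    case True
    then show ?thesis
      using \<sigma> by (auto simp: insert_absorb)
  next
    case False
    have "\<exists>k. k \<notin> \<sigma> ` I \<and> \<theta> * \<bar>b j\<bar> \<le> \<bar>a k\<bar>"
    proof (cases "b j = 0")
      case True
      then show ?thesis
        using ex_new_if_finite[of "\<sigma> ` I"] insert(1) by auto
    next
      case False
      define t where "t = \<theta> * \<bar>b j\<bar>"
      have t: "0 < t" "t < \<bar>b j\<bar>"
        using False assms by (auto simp: t_def)
      have sub: "insert j I \<subseteq> {i. \<bar>b i\<bar> > t}"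
        using insert(2) t by fastforce
      \<comment> \<open>Otherwise the level set of \<open>a\<close> would be finite with at most
        \<open>card I\<close> elements, while that of \<open>b\<close> has at least one
        more.\<close>
      have "\<not> {i. \<bar>a i\<bar> > t} \<subseteq> \<sigma> ` I"
      proof
        assume le: "{i. \<bar>a i\<bar> > t} \<subseteq> \<sigma> ` I"
        then have fin: "finite {i. \<bar>a i\<bar> > t}"
          using insert(1) finite_subset by blast
        then have b: "finite {i. \<bar>b i\<bar> > t}" "card {i. \<bar>b i\<bar> > t} \<le> card {i. \<bar>a i\<bar> > t}"
          using assms(1)[OF t(1)] by (auto simp: card_le_def)
        have "Suc (card I) \<le> card {i. \<bar>b i\<bar> > t}"
          using card_mono[OF b(1) sub] \<open>j \<notin> I\<close> insert(1) by simp
        also have "\<dots> \<le> card I"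
          using b(2) card_mono[OF _ le] card_image_le[of I \<sigma>] insert(1) by fastforce
        finally show False by simp
      qed
      then show ?thesis
        by (auto simp: t_def less_imp_le)
    qed
    then obtain k where k: "k \<notin> \<sigma> ` I" "\<theta> * \<bar>b j\<bar> \<le> \<bar>a k\<bar>"
      by blast
    have eq: "(\<sigma>(j := k)) ` I = \<sigma> ` I"
      using False by (auto simp: fun_upd_image)
    show ?thesis
      using \<sigma> k False
      by (intro exI[of _ "\<sigma>(j := k)"]) (auto simp: inj_on_def image_iff)
  qed
qed auto

lemma (in finite_lattice_norms) rearrangement_invariant_space:
  assumes inj: "\<And>n m \<sigma> a. inj_on \<sigma> {..<n} \<Longrightarrow> \<sigma> ` {..<n} \<subseteq> {..<m} \<Longrightarrow> N n (\<lambda>i. a (\<sigma> i)) \<le> N m a"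
  shows "rearrangement_invariant space norm_sup"
proof -
  have "b \<in> space \<and> norm_sup b \<le> norm_sup a"
    if a: "a \<in> space" and b: "\<forall>t>0. card_le {i. \<bar>b i\<bar> > t} {i. \<bar>a i\<bar> > t}" for a b
  proof (rule norm_supI)
    fix n
    have le: "\<theta> * N n b \<le> norm_sup a" if \<theta>: "0 < \<theta>" "\<theta> < 1" for \<theta>
    proof -
      obtain \<sigma> where \<sigma>: "inj_on \<sigma> {..<n}" "\<forall>i\<in>{..<n}. \<theta> * \<bar>b i\<bar> \<le> \<bar>a (\<sigma> i)\<bar>"
        using exists_dominating_injection[OF _ finite_lessThan \<theta>, of b a n] b by blast
      obtain m where m: "\<sigma> ` {..<n} \<subseteq> {..<m}"
        using finite_nat_bounded[of "\<sigma> ` {..<n}"] by auto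
      have "\<theta> * N n b = N n (\<lambda>i. \<theta> * b i)"
        using \<theta> by (simp add: scale)
      also have "\<dots> \<le> N n (\<lambda>i. a (\<sigma> i))"
        using \<sigma> \<theta> by (intro mono) (auto simp: abs_mult)
      also have "\<dots> \<le> N m a"
        using \<sigma> m by (intro inj)
      also have "\<dots> \<le> norm_sup a"
        using a by (rule le_norm_sup)
      finally show ?thesis .
    qed
    \<comment> \<open>Let \<open>\<theta>\<close> tend to 1.\<close>
    then show "N n b \<le> norm_sup a"
      by (metis field_le_mult_one_interval)
  qed
  then show ?thesis
    using banach_seq_lattice_space by (simp add: rearrangement_invariant_def)
qed

section \<open>The upper and lower norms\<close>

definition normalized_on :: "'i set \<Rightarrow> ('i \<Rightarrow> 'a::{banach, ordered_real_vector, lattice}) \<Rightarrow> bool" where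
  "normalized_on I x \<longleftrightarrow> disjoint_on I x \<and> (\<forall>i\<in>I. norm (x i) = 1)"

lemma Btuples_iff: "x \<in> Btuples n \<longleftrightarrow> normalized_on {..<n} x"
  by (auto simp: Btuples_def normalized_on_def disjoint_on_def)

text \<open>This bound does not depend on \<open>x\<close>, so the supremum defining
  \<open>XU_n\<close> is over a bounded set.\<close>

lemma norm_sum_normalized_le:
  assumes "normalized_on I x"
  shows "norm (\<Sum>i\<in>I. a i *\<^sub>R x i) \<le> (\<Sum>i\<in>I. \<bar>a i\<bar>)"
  using assms by (intro norm_sum[THEN order_trans] sum_mono) (auto simp: normalized_on_def)

lemma coord_le_norm_sum_normalized:
  fixes x :: "'i \<Rightarrow> 'a::{banach, ordered_real_vector, lattice}"
  assumes "banach_lattice_norm TYPE('a)" "finite I" "normalized_on I x" "i \<in> I"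
  shows "\<bar>a i\<bar> \<le> norm (\<Sum>i\<in>I. a i *\<^sub>R x i)"
proof -
  have "norm (\<Sum>i\<in>{i}. a i *\<^sub>R x i) \<le> norm (\<Sum>i\<in>I. a i *\<^sub>R x i)"
    using assms by (intro norm_sum_disjoint_mono) (auto simp: normalized_on_def disjoint_on_def)
  then show ?thesis
    using assms by (simp add: normalized_on_def)
qed

lemma normalized_on_reindex:
  "normalized_on J x \<Longrightarrow> inj_on \<sigma> I \<Longrightarrow> \<sigma> ` I \<subseteq> J \<Longrightarrow> normalized_on I (\<lambda>i. x (\<sigma> i))"
  unfolding normalized_on_def disjoint_on_def inj_on_def by (simp add: image_subset_iff) metis

lemma norm_sum_normalized_mono:
  fixes x :: "'i \<Rightarrow> 'a::{banach, ordered_real_vector, lattice}"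
  assumes "banach_lattice_norm TYPE('a)" "finite J" "normalized_on J x" "I \<subseteq> J"
    and "\<And>i. i \<in> I \<Longrightarrow> \<bar>b i\<bar> \<le> \<bar>a i\<bar>"
  shows "norm (\<Sum>i\<in>I. b i *\<^sub>R x i) \<le> norm (\<Sum>i\<in>J. a i *\<^sub>R x i)"
  using assms disjoint_on_subset[of J x I]
  by (intro norm_sum_disjoint_mono) (auto simp: normalized_on_def intro: scaleR_right_mono)

lemma norm_sum_normalized_reindex_le:
  fixes x :: "'i \<Rightarrow> 'a::{banach, ordered_real_vector, lattice}"
  assumes "banach_lattice_norm TYPE('a)" "finite J" "normalized_on J x" "inj_on \<sigma> I" "\<sigma> ` I \<subseteq> J"
  shows "norm (\<Sum>i\<in>I. a (\<sigma> i) *\<^sub>R x (\<sigma> i)) \<le> norm (\<Sum>j\<in>J. a j *\<^sub>R x j)"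
  using norm_sum_normalized_mono[OF assms(1-3,5) order.refl, of a]
  by (simp add: sum.reindex[OF assms(4)] o_def)

locale inf_dim_banach_lattice =
  fixes T :: "'a::{banach, ordered_real_vector, lattice} itself"
  assumes bl: "banach_lattice_norm TYPE('a)"
    and inf_dim: "infinite_dimensional TYPE('a)"
begin

text \<open>Without members, the real suprema and infima over \<open>Btuples n\<close> would carry
  no information.\<close>

lemma Btuples_nonempty: "(Btuples n :: (nat \<Rightarrow> 'a) set) \<noteq> {}"
proof -
  obtain y :: "nat \<Rightarrow> 'a" where y: "disjoint_on {..<n} y" "\<forall>i<n. 0 \<le> y i \<and> y i \<noteq> 0"
    using exists_disjoint_family[OF bl inf_dim] by blast
  then have "(\<lambda>i. (1 / norm (y i)) *\<^sub>R y i) \<in> Btuples n"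
    by (auto simp: Btuples_def disjoint_on_def ldisjoint_scaleR)
  then show ?thesis by blast
qed

lemma le_XU_n: "(x :: nat \<Rightarrow> 'a) \<in> Btuples n \<Longrightarrow> norm (\<Sum>i<n. a i *\<^sub>R x i) \<le> XU_n TYPE('a) n a"
  unfolding XU_n_def
  by (intro cSUP_upper bdd_aboveI2[where M = "\<Sum>i<n. \<bar>a i\<bar>"])
    (auto simp: Btuples_iff norm_sum_normalized_le)

lemma XU_n_le:
  "(\<And>x :: nat \<Rightarrow> 'a. x \<in> Btuples n \<Longrightarrow> norm (\<Sum>i<n. a i *\<^sub>R x i) \<le> C) \<Longrightarrow> XU_n TYPE('a) n a \<le> C"
  unfolding XU_n_def by (intro cSUP_least Btuples_nonempty)

lemma Phi_n_le: "(x :: nat \<Rightarrow> 'a) \<in> Btuples n \<Longrightarrow> Phi_n TYPE('a) n a \<le> norm (\<Sum>i<n. a i *\<^sub>R x i)"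
  unfolding Phi_n_def by (intro cINF_lower bdd_belowI2[where m = 0]) auto

lemma le_Phi_n:
  "(\<And>x :: nat \<Rightarrow> 'a. x \<in> Btuples n \<Longrightarrow> C \<le> norm (\<Sum>i<n. a i *\<^sub>R x i)) \<Longrightarrow> C \<le> Phi_n TYPE('a) n a"
  unfolding Phi_n_def by (intro cINF_greatest Btuples_nonempty)

lemma Phi_n_nonneg: "0 \<le> Phi_n TYPE('a) n a"
  by (rule le_Phi_n) simp

lemma XL_n_le:
  fixes A :: "nat \<Rightarrow> nat \<Rightarrow> real"
  assumes "finite F" "\<And>i. i < n \<Longrightarrow> a i = (\<Sum>k\<in>F. A k i)"
  shows "XL_n TYPE('a) n a \<le> (\<Sum>k\<in>F. Phi_n TYPE('a) n (A k))"
  unfolding XL_n_def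
proof (rule cInf_lower)
  show "bdd_below {(\<Sum>k\<in>F. Phi_n TYPE('a) n (A k)) | F (A :: nat \<Rightarrow> nat \<Rightarrow> real).
      finite F \<and> (\<forall>i<n. a i = (\<Sum>k\<in>F. A k i))}"
    by (rule bdd_belowI[where m = 0]) (auto intro: sum_nonneg Phi_n_nonneg)
  show "(\<Sum>k\<in>F. Phi_n TYPE('a) n (A k)) \<in> {(\<Sum>k\<in>F. Phi_n TYPE('a) n (A k)) | F (A :: nat \<Rightarrow> nat \<Rightarrow> real).
      finite F \<and> (\<forall>i<n. a i = (\<Sum>k\<in>F. A k i))}"
    by (intro CollectI exI[of _ F] exI[of _ A]) (simp add: assms)
qed

lemma le_XL_n:
  assumes "\<And>F (A :: nat \<Rightarrow> nat \<Rightarrow> real). finite F \<Longrightarrow> (\<And>i. i < n \<Longrightarrow> a i = (\<Sum>k\<in>F. A k i))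
    \<Longrightarrow> C \<le> (\<Sum>k\<in>F. Phi_n TYPE('a) n (A k))"
  shows "C \<le> XL_n TYPE('a) n a"
proof -
  have *: "\<exists>F (A :: nat \<Rightarrow> nat \<Rightarrow> real). finite F \<and> (\<forall>i<n. a i = (\<Sum>k\<in>F. A k i))"
    by (intro exI[of _ "{0}"] exI[of _ "\<lambda>_. a"]) simp
  show ?thesis
    unfolding XL_n_def
  proof (rule cInf_greatest)
    fix s assume "s \<in> {(\<Sum>k\<in>F. Phi_n TYPE('a) n (A k)) | F (A :: nat \<Rightarrow> nat \<Rightarrow> real).
      finite F \<and> (\<forall>i<n. a i = (\<Sum>k\<in>F. A k i))}"
    then obtain F and A :: "nat \<Rightarrow> nat \<Rightarrow> real" where FA: "finite F" "\<forall>i<n. a i = (\<Sum>k\<in>F. A k i)"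
      and s: "s = (\<Sum>k\<in>F. Phi_n TYPE('a) n (A k))"
      by blast
    show "C \<le> s"
      unfolding s using FA by (intro assms) auto
  qed (use * in blast)
qed

lemma finite_lattice_norms_XU: "finite_lattice_norms (XU_n TYPE('a))"
proof
  fix n c and a b :: "nat \<Rightarrow> real"
  have le: "XU_n TYPE('a) n (\<lambda>i. c * a i) \<le> \<bar>c\<bar> * XU_n TYPE('a) n a" for c a
  proof (rule XU_n_le)
    fix x :: "nat \<Rightarrow> 'a" assume x: "x \<in> Btuples n"
    have "norm (\<Sum>i<n. (c * a i) *\<^sub>R x i) = \<bar>c\<bar> * norm (\<Sum>i<n. a i *\<^sub>R x i)"
      by (simp flip: scaleR_scaleR scaleR_sum_right)
    then show "norm (\<Sum>i<n. (c * a i) *\<^sub>R x i) \<le> \<bar>c\<bar> * XU_n TYPE('a) n a"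
      using le_XU_n[OF x, of a] by (simp add: mult_left_mono)
  qed
  show "XU_n TYPE('a) n (\<lambda>i. c * a i) = \<bar>c\<bar> * XU_n TYPE('a) n a"
  proof (rule antisym[OF le])
    show "\<bar>c\<bar> * XU_n TYPE('a) n a \<le> XU_n TYPE('a) n (\<lambda>i. c * a i)"
    proof (cases "c = 0")
      case True
      obtain x :: "nat \<Rightarrow> 'a" where "x \<in> Btuples n"
        using Btuples_nonempty by blast
      from le_XU_n[OF this, of "\<lambda>i. 0"] show ?thesis
        using True by simp
    next
      case False
      then show ?thesis
        using le[of "1 / c" "\<lambda>i. c * a i"] by (simp add: field_simps)
    qed
  qed
  show "XU_n TYPE('a) n (\<lambda>i. a i + b i) \<le> XU_n TYPE('a) n a + XU_n TYPE('a) n b"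
  proof (rule XU_n_le)
    fix x :: "nat \<Rightarrow> 'a" assume x: "x \<in> Btuples n"
    show "norm (\<Sum>i<n. (a i + b i) *\<^sub>R x i) \<le> XU_n TYPE('a) n a + XU_n TYPE('a) n b"
      unfolding scaleR_left_distrib sum.distrib
      by (intro norm_triangle_mono le_XU_n x)
  qed
  show "XU_n TYPE('a) n b \<le> XU_n TYPE('a) n a" if "\<And>i. i < n \<Longrightarrow> \<bar>b i\<bar> \<le> \<bar>a i\<bar>"
  proof (rule XU_n_le)
    fix x :: "nat \<Rightarrow> 'a" assume x: "x \<in> Btuples n"
    have "norm (\<Sum>i<n. b i *\<^sub>R x i) \<le> norm (\<Sum>i<n. a i *\<^sub>R x i)"
      using x that by (intro norm_sum_normalized_mono[OF bl]) (auto simp: Btuples_iff)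
    also have "\<dots> \<le> XU_n TYPE('a) n a"
      by (rule le_XU_n[OF x])
    finally show "norm (\<Sum>i<n. b i *\<^sub>R x i) \<le> XU_n TYPE('a) n a" .
  qed
  show "\<bar>a i\<bar> \<le> XU_n TYPE('a) n a" if "i < n" for i
  proof -
    obtain x :: "nat \<Rightarrow> 'a" where x: "x \<in> Btuples n"
      using Btuples_nonempty by blast
    have "\<bar>a i\<bar> \<le> norm (\<Sum>i<n. a i *\<^sub>R x i)"
      using x that by (intro coord_le_norm_sum_normalized[OF bl]) (auto simp: Btuples_iff)
    then show ?thesis
      using le_XU_n[OF x, of a] by simp
  qed
qed

section \<open>The lower norm\<close>

text \<open>An infimum of norms inherits homogeneity and monotonicity, but in general no triangle
  inequality; the decompositions in \<open>XL_n\<close> supply it.\<close>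

lemma Phi_n_scale_le: "Phi_n TYPE('a) n (\<lambda>i. c * a i) \<le> \<bar>c\<bar> * Phi_n TYPE('a) n a"
proof (cases "c = 0")
  case True
  obtain x :: "nat \<Rightarrow> 'a" where "x \<in> Btuples n"
    using Btuples_nonempty by blast
  from Phi_n_le[OF this, of "\<lambda>i. 0"] show ?thesis
    using True by simp
next
  case False
  have "Phi_n TYPE('a) n (\<lambda>i. c * a i) / \<bar>c\<bar> \<le> Phi_n TYPE('a) n a"
  proof (rule le_Phi_n)
    fix x :: "nat \<Rightarrow> 'a" assume x: "x \<in> Btuples n"
    have "norm (\<Sum>i<n. (c * a i) *\<^sub>R x i) = \<bar>c\<bar> * norm (\<Sum>i<n. a i *\<^sub>R x i)"
      by (simp flip: scaleR_scaleR scaleR_sum_right)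
    then show "Phi_n TYPE('a) n (\<lambda>i. c * a i) / \<bar>c\<bar> \<le> norm (\<Sum>i<n. a i *\<^sub>R x i)"
      using Phi_n_le[OF x, of "\<lambda>i. c * a i"] False by (simp add: field_simps)
  qed
  then show ?thesis
    using False by (simp add: field_simps)
qed

lemma Phi_n_mono:
  assumes "\<And>i. i < n \<Longrightarrow> \<bar>b i\<bar> \<le> \<bar>a i\<bar>"
  shows "Phi_n TYPE('a) n b \<le> Phi_n TYPE('a) n a"
proof (rule le_Phi_n)
  fix x :: "nat \<Rightarrow> 'a" assume x: "x \<in> Btuples n"
  have "Phi_n TYPE('a) n b \<le> norm (\<Sum>i<n. b i *\<^sub>R x i)"
    by (rule Phi_n_le[OF x])
  also have "\<dots> \<le> norm (\<Sum>i<n. a i *\<^sub>R x i)"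
    using x assms by (intro norm_sum_normalized_mono[OF bl]) (auto simp: Btuples_iff)
  finally show "Phi_n TYPE('a) n b \<le> norm (\<Sum>i<n. a i *\<^sub>R x i)" .
qed

lemma coord_le_Phi_n: "i < n \<Longrightarrow> \<bar>a i\<bar> \<le> Phi_n TYPE('a) n a"
  by (rule le_Phi_n, rule coord_le_norm_sum_normalized[OF bl]) (auto simp: Btuples_iff)

lemma Phi_n_reindex:
  assumes "inj_on \<sigma> {..<n}" "\<sigma> ` {..<n} \<subseteq> {..<m}"
  shows "Phi_n TYPE('a) n (\<lambda>i. a (\<sigma> i)) \<le> Phi_n TYPE('a) m a"
proof (rule le_Phi_n)
  fix x :: "nat \<Rightarrow> 'a" assume x: "x \<in> Btuples m"
  have "Phi_n TYPE('a) n (\<lambda>i. a (\<sigma> i)) \<le> norm (\<Sum>i<n. a (\<sigma> i) *\<^sub>R x (\<sigma> i))"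
    using x assms normalized_on_reindex by (intro Phi_n_le) (auto simp: Btuples_iff)
  also have "\<dots> \<le> norm (\<Sum>i<m. a i *\<^sub>R x i)"
    using x assms by (intro norm_sum_normalized_reindex_le[OF bl]) (auto simp: Btuples_iff)
  finally show "Phi_n TYPE('a) n (\<lambda>i. a (\<sigma> i)) \<le> norm (\<Sum>i<m. a i *\<^sub>R x i)" .
qed

text \<open>Two decompositions are concatenated for the triangle inequality. For monotonicity, every
  summand of a decomposition of \<open>a\<close> is multiplied coordinatewise by the quotients
  \<open>b i / a i\<close>, which turns it into one of \<open>b\<close> without increasing any
  \<open>Phi_n\<close>.\<close>

lemma finite_lattice_norms_XL: "finite_lattice_norms (XL_n TYPE('a))"
proof
  fix n c and a b :: "nat \<Rightarrow> real"
  have le: "XL_n TYPE('a) n (\<lambda>i. c * a i) \<le> \<bar>c\<bar> * XL_n TYPE('a) n a" if c: "c \<noteq> 0" for c a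
  proof -
    have "XL_n TYPE('a) n (\<lambda>i. c * a i) / \<bar>c\<bar> \<le> XL_n TYPE('a) n a"
    proof (rule le_XL_n)
      fix F and A :: "nat \<Rightarrow> nat \<Rightarrow> real"
      assume FA: "finite F" "\<And>i. i < n \<Longrightarrow> a i = (\<Sum>k\<in>F. A k i)"
      have "XL_n TYPE('a) n (\<lambda>i. c * a i) \<le> (\<Sum>k\<in>F. Phi_n TYPE('a) n (\<lambda>i. c * A k i))"
        using FA by (intro XL_n_le) (auto simp: sum_distrib_left)
      also have "\<dots> \<le> (\<Sum>k\<in>F. \<bar>c\<bar> * Phi_n TYPE('a) n (A k))"
        by (intro sum_mono Phi_n_scale_le)
      finally show "XL_n TYPE('a) n (\<lambda>i. c * a i) / \<bar>c\<bar> \<le> (\<Sum>k\<in>F. Phi_n TYPE('a) n (A k))"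
        using c by (simp add: field_simps sum_distrib_left)
    qed
    then show ?thesis
      using c by (simp add: field_simps)
  qed
  show "XL_n TYPE('a) n (\<lambda>i. c * a i) = \<bar>c\<bar> * XL_n TYPE('a) n a"
  proof (cases "c = 0")
    case True
    have "XL_n TYPE('a) n (\<lambda>i. 0) \<le> 0"
      using XL_n_le[of "{}" n "\<lambda>i. 0"] by simp
    moreover have "0 \<le> XL_n TYPE('a) n (\<lambda>i. 0)"
      by (intro le_XL_n sum_nonneg Phi_n_nonneg)
    ultimately show ?thesis
      using True by simp
  next
    case False
    then have "\<bar>c\<bar> * XL_n TYPE('a) n a \<le> XL_n TYPE('a) n (\<lambda>i. c * a i)"
      using le[of "1 / c" "\<lambda>i. c * a i"] by (simp add: field_simps)
    then show ?thesis
      using le[OF False, of a] by simp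
  qed
  have "XL_n TYPE('a) n (\<lambda>i. a i + b i) - XL_n TYPE('a) n b \<le> XL_n TYPE('a) n a"
  proof (rule le_XL_n)
    fix F and A :: "nat \<Rightarrow> nat \<Rightarrow> real"
    assume FA: "finite F" "\<And>i. i < n \<Longrightarrow> a i = (\<Sum>k\<in>F. A k i)"
    have "XL_n TYPE('a) n (\<lambda>i. a i + b i) - (\<Sum>k\<in>F. Phi_n TYPE('a) n (A k)) \<le> XL_n TYPE('a) n b"
    proof (rule le_XL_n)
      fix G and B :: "nat \<Rightarrow> nat \<Rightarrow> real"
      assume GB: "finite G" "\<And>i. i < n \<Longrightarrow> b i = (\<Sum>k\<in>G. B k i)"
      \<comment> \<open>\<open>F\<close> and \<open>G\<close> are arbitrary finite sets of naturals
        and may overlap; even and odd indices keep the two decompositions apart.\<close>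
      define H where "H = (\<lambda>k. 2 * k) ` F \<union> (\<lambda>k. 2 * k + 1) ` G"
      define C where "C k = (if even k then A (k div 2) else B (k div 2))" for k
      have sum_H: "(\<Sum>k\<in>H. f (C k)) = (\<Sum>k\<in>F. f (A k)) + (\<Sum>k\<in>G. f (B k))"
        for f :: "_ \<Rightarrow> real"
      proof -
        have "(\<lambda>k. 2 * k) ` F \<inter> (\<lambda>k. 2 * k + 1) ` G = {}"
          by (auto, presburger)
        then have "(\<Sum>k\<in>H. f (C k))
            = (\<Sum>k\<in>(\<lambda>k. 2 * k) ` F. f (C k)) + (\<Sum>k\<in>(\<lambda>k. 2 * k + 1) ` G. f (C k))"
          unfolding H_def using FA GB by (intro sum.union_disjoint) auto
        then show ?thesis
          by (simp add: sum.reindex inj_on_def C_def)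
      qed
      have "XL_n TYPE('a) n (\<lambda>i. a i + b i) \<le> (\<Sum>k\<in>H. Phi_n TYPE('a) n (C k))"
        using FA GB sum_H[of "\<lambda>a. a _"] by (intro XL_n_le) (auto simp: H_def)
      then show "XL_n TYPE('a) n (\<lambda>i. a i + b i) - (\<Sum>k\<in>F. Phi_n TYPE('a) n (A k))
          \<le> (\<Sum>k\<in>G. Phi_n TYPE('a) n (B k))"
        by (simp add: sum_H)
    qed
    then show "XL_n TYPE('a) n (\<lambda>i. a i + b i) - XL_n TYPE('a) n b \<le> (\<Sum>k\<in>F. Phi_n TYPE('a) n (A k))"
      by simp
  qed
  then show "XL_n TYPE('a) n (\<lambda>i. a i + b i) \<le> XL_n TYPE('a) n a + XL_n TYPE('a) n b"
    by simp
  show "XL_n TYPE('a) n b \<le> XL_n TYPE('a) n a" if ba: "\<And>i. i < n \<Longrightarrow> \<bar>b i\<bar> \<le> \<bar>a i\<bar>"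
  proof (rule le_XL_n)
    fix F and A :: "nat \<Rightarrow> nat \<Rightarrow> real"
    assume FA: "finite F" "\<And>i. i < n \<Longrightarrow> a i = (\<Sum>k\<in>F. A k i)"
    \<comment> \<open>Where \<open>a i = 0\<close>, also \<open>b i = 0\<close>, and division by
      zero gives the harmless value 0.\<close>
    define \<theta> where "\<theta> i = b i / a i" for i
    have \<theta>: "b i = \<theta> i * a i" "\<bar>\<theta> i\<bar> \<le> 1" if "i < n" for i
      using ba[OF that] by (auto simp: \<theta>_def field_simps divide_le_eq_1)
    have "XL_n TYPE('a) n b \<le> (\<Sum>k\<in>F. Phi_n TYPE('a) n (\<lambda>i. \<theta> i * A k i))"
      using FA \<theta>(1) by (intro XL_n_le) (auto simp: sum_distrib_left)
    also have "\<dots> \<le> (\<Sum>k\<in>F. Phi_n TYPE('a) n (A k))"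
      using \<theta>(2) by (intro sum_mono Phi_n_mono) (auto simp: abs_mult mult_left_le_one_le)
    finally show "XL_n TYPE('a) n b \<le> (\<Sum>k\<in>F. Phi_n TYPE('a) n (A k))" .
  qed
  show "\<bar>a i\<bar> \<le> XL_n TYPE('a) n a" if "i < n" for i
  proof (rule le_XL_n)
    fix F and A :: "nat \<Rightarrow> nat \<Rightarrow> real"
    assume FA: "finite F" "\<And>i. i < n \<Longrightarrow> a i = (\<Sum>k\<in>F. A k i)"
    have "\<bar>a i\<bar> \<le> (\<Sum>k\<in>F. \<bar>A k i\<bar>)"
      using FA(2)[OF that] by simp
    also have "\<dots> \<le> (\<Sum>k\<in>F. Phi_n TYPE('a) n (A k))"
      using that by (intro sum_mono coord_le_Phi_n)
    finally show "\<bar>a i\<bar> \<le> (\<Sum>k\<in>F. Phi_n TYPE('a) n (A k))" .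
  qed
qed

lemma XL_n_reindex:
  assumes "inj_on \<sigma> {..<n}" "\<sigma> ` {..<n} \<subseteq> {..<m}"
  shows "XL_n TYPE('a) n (\<lambda>i. a (\<sigma> i)) \<le> XL_n TYPE('a) m a"
proof (rule le_XL_n)
  fix F and A :: "nat \<Rightarrow> nat \<Rightarrow> real"
  assume FA: "finite F" "\<And>i. i < m \<Longrightarrow> a i = (\<Sum>k\<in>F. A k i)"
  have "XL_n TYPE('a) n (\<lambda>i. a (\<sigma> i)) \<le> (\<Sum>k\<in>F. Phi_n TYPE('a) n (\<lambda>i. A k (\<sigma> i)))"
    using FA assms by (intro XL_n_le) auto
  also have "\<dots> \<le> (\<Sum>k\<in>F. Phi_n TYPE('a) m (A k))"
    using assms by (intro sum_mono Phi_n_reindex)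
  finally show "XL_n TYPE('a) n (\<lambda>i. a (\<sigma> i)) \<le> (\<Sum>k\<in>F. Phi_n TYPE('a) m (A k))" .
qed

end

section \<open>Extending disjoint systems\<close>

lemma abs_le_linf_norm: "i < n \<Longrightarrow> \<bar>a i\<bar> \<le> linf_norm n a"
  by (auto simp: linf_norm_def intro!: Max_ge)

lemma linf_norm_le: "(\<And>i. i < n \<Longrightarrow> \<bar>a i\<bar> \<le> C) \<Longrightarrow> 0 \<le> C \<Longrightarrow> linf_norm n a \<le> C"
  by (cases "n = 0") (auto simp: linf_norm_def intro!: Max.boundedI)

lemma linf_norm_nonneg: "0 \<le> linf_norm n a"
  by (cases n) (auto simp: linf_norm_def intro!: order_trans[OF abs_ge_zero Max_ge])

context inf_dim_banach_lattice
begin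

text \<open>The defining condition of \<open>linf_flr\<close> for one pair of parameters, so that
  its failure yields a fixed \<open>n\<close> and \<open>e\<close> to work with.\<close>

definition linf_copy :: "nat \<Rightarrow> real \<Rightarrow> bool" where
  "linf_copy n e \<longleftrightarrow> (\<exists>x::nat \<Rightarrow> 'a. disjoint_on {..<n} x \<and>
      (\<forall>a. linf_norm n a \<le> norm (\<Sum>i<n. a i *\<^sub>R x i) \<and>
           norm (\<Sum>i<n. a i *\<^sub>R x i) \<le> (1 + e) * linf_norm n a))"

text \<open>If all \<open>u i\<close> had norm above \<open>C / (1 + e)\<close>, scaling by
  \<open>(1 + e) / C\<close> would make each norm at least 1 and the norm of the sum at most
  \<open>1 + e\<close>. For disjoint elements of a Banach lattice these two facts already give the
  l_infty estimates for all coefficients.\<close>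

lemma linf_copy_free_step:
  fixes u :: "nat \<Rightarrow> 'a"
  assumes no_copy: "\<not> linf_copy n e"
    and e: "0 < e" and u: "disjoint_on {..<n} u" "norm (\<Sum>i<n. u i) \<le> C"
  shows "\<exists>i<n. norm (u i) * (1 + e) \<le> C"
proof (rule ccontr)
  assume "\<not> ?thesis"
  then have big: "C < norm (u i) * (1 + e)" if "i < n" for i
    using that by (auto simp: not_le)
  have "n \<noteq> 0"
  proof
    assume "n = 0"
    then show False
      using no_copy by (auto simp: linf_copy_def disjoint_on_def linf_norm_def)
  qed
  have C: "0 < C"
  proof -
    have "norm (\<Sum>i\<in>{0}. 1 *\<^sub>R u i) \<le> norm (\<Sum>i<n. 1 *\<^sub>R u i)"
      using u \<open>n \<noteq> 0\<close> by (intro norm_sum_disjoint_mono[OF bl]) (auto simp: disjoint_on_def)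
    then have "norm (u 0) \<le> C"
      using u by simp
    moreover have "norm (u 0) \<noteq> 0"
    proof
      assume "norm (u 0) = 0"
      then have "C < 0"
        using big[of 0] \<open>n \<noteq> 0\<close> by simp
      then show False
        using u norm_ge_zero[of "\<Sum>i<n. u i"] by linarith
    qed
    ultimately show ?thesis
      using norm_ge_zero[of "u 0"] by linarith
  qed
  define x where "x i = ((1 + e) / C) *\<^sub>R u i" for i
  have x: "disjoint_on {..<n} x"
    using u by (auto simp: disjoint_on_def x_def intro: ldisjoint_scaleR)
  have norm_x: "1 \<le> norm (x i)" if "i < n" for i
    using big[OF that] C e by (simp add: x_def field_simps)
  have "(\<Sum>i<n. x i) = ((1 + e) / C) *\<^sub>R (\<Sum>i<n. u i)"
    by (simp add: x_def scaleR_sum_right)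
  then have "norm (\<Sum>i<n. x i) = (1 + e) / C * norm (\<Sum>i<n. u i)"
    using C e by simp
  also have "\<dots> \<le> (1 + e) / C * C"
    using u C e by (intro mult_left_mono) auto
  finally have sum_x: "norm (\<Sum>i<n. x i) \<le> 1 + e"
    using C by simp
  have "linf_norm n a \<le> norm (\<Sum>i<n. a i *\<^sub>R x i)" for a
  proof (rule linf_norm_le)
    fix i assume i: "i < n"
    have "\<bar>a i\<bar> \<le> \<bar>a i\<bar> * norm (x i)"
      using mult_left_mono[OF norm_x[OF i], of "\<bar>a i\<bar>"] by simp
    also have "\<dots> = norm (\<Sum>i\<in>{i}. a i *\<^sub>R x i)"
      by simp
    also have "\<dots> \<le> norm (\<Sum>i<n. a i *\<^sub>R x i)"
      using x i by (intro norm_sum_disjoint_mono[OF bl]) (auto simp: disjoint_on_def)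
    finally show "\<bar>a i\<bar> \<le> norm (\<Sum>i<n. a i *\<^sub>R x i)" .
  qed simp
  moreover have "norm (\<Sum>i<n. a i *\<^sub>R x i) \<le> (1 + e) * linf_norm n a" for a
  proof -
    have "norm (\<Sum>i<n. a i *\<^sub>R x i) \<le> norm (\<Sum>i<n. linf_norm n a *\<^sub>R x i)"
      using x abs_le_linf_norm[of _ n a] linf_norm_nonneg[of n a]
      by (intro norm_sum_disjoint_mono[OF bl]) (auto intro!: scaleR_right_mono)
    also have "\<dots> = linf_norm n a * norm (\<Sum>i<n. x i)"
      using linf_norm_nonneg[of n a] by (simp flip: scaleR_sum_right)
    also have "\<dots> \<le> linf_norm n a * (1 + e)"
      by (intro mult_left_mono sum_x linf_norm_nonneg)
    finally show ?thesis by (simp add: mult.commute)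
  qed
  ultimately show False
    using no_copy x unfolding linf_copy_def by blast
qed

text \<open>James' distortion argument: if the children of every node of the \<open>n\<close>-ary tree of partial sums
  fail to span a \<open>(1 + e)\<close>-copy of \<open>\<ell>\<^sub>\<infinity>\<^sup>n\<close>, the smallest child is smaller than its parent by a
  factor \<open>1 + e\<close>.\<close>

lemma linf_copy_free_tree:
  fixes w :: "nat \<Rightarrow> 'a"
  assumes no_copy: "\<not> linf_copy n e"
    and e: "0 < e" and w: "disjoint_on {..<n ^ r} w" "norm (\<Sum>k<n ^ r. w k) \<le> C"
  shows "\<exists>k<n ^ r. norm (w k) * (1 + e) ^ r \<le> C"
  using w
proof (induction r arbitrary: w C)
  case 0
  then show ?case by simp
next
  case (Suc r)
  define m where "m = n ^ r"
  \<comment> \<open>Leaves below child \<open>i\<close> carry the consecutive indices from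
    \<open>i * m\<close>, and \<open>u i\<close> is the partial sum at that child.\<close>
  define u where "u i = sum w {i * m..<i * m + m}" for i
  have m: "n ^ Suc r = n * m"
    by (simp add: m_def)
  have le: "i * m + j < n * m" if "i < n" "j < m" for i j
  proof -
    have "i * m + j < Suc i * m"
      using that by simp
    also have "\<dots> \<le> n * m"
      using that by (intro mult_le_mono1) simp
    finally show ?thesis .
  qed
  have block: "\<exists>j<m. k = i * m + j" if "k \<in> {i * m..<i * m + m}" for k i
    using that by (intro exI[of _ "k - i * m"]) auto
  have "disjoint_on {..<n} u"
    unfolding disjoint_on_def
  proof (intro ballI impI)
    fix i i' assume i: "i \<in> {..<n}" "i' \<in> {..<n}" "i \<noteq> i'"
    have "ldisjoint (w k) (w k')" if kk: "k \<in> {i * m..<i * m + m}" "k' \<in> {i' * m..<i' * m + m}" for k k'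
    proof -
      obtain j where j: "j < m" "k = i * m + j"
        using block[OF kk(1)] by blast
      obtain j' where j': "j' < m" "k' = i' * m + j'"
        using block[OF kk(2)] by blast
      have "k div m = i" "k' div m = i'"
        using j j'
        by simp_all
      then have "k \<noteq> k'"
        using i by blast
      then show ?thesis
        using Suc.prems(1) i j j' le m by (auto simp: disjoint_on_def)
    qed
    then show "ldisjoint (u i) (u i')"
      unfolding u_def by (intro ldisjoint_sum) (meson ldisjoint_commute ldisjoint_sum)
  qed
  moreover have "norm (\<Sum>i<n. u i) \<le> C"
    using Suc.prems(2) sum.nat_group[of w m n] unfolding u_def m by simp
  ultimately obtain i where i: "i < n" "norm (u i) * (1 + e) \<le> C"
    using linf_copy_free_step[OF no_copy e] by blast
  have "disjoint_on {..<n ^ r} (\<lambda>j. w (i * m + j))"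
    using Suc.prems(1) i le m by (auto simp: disjoint_on_def m_def)
  moreover have "norm (\<Sum>j<n ^ r. w (i * m + j)) \<le> C / (1 + e)"
  proof -
    have "u i = (\<Sum>j<m. w (i * m + j))"
      unfolding u_def using sum.shift_bounds_nat_ivl[of w 0 "i * m" m]
      by (simp add: atLeast0LessThan add.commute)
    then show ?thesis
      using i e by (simp add: m_def field_simps)
  qed
  ultimately obtain j where j: "j < n ^ r" "norm (w (i * m + j)) * (1 + e) ^ r \<le> C / (1 + e)"
    using Suc.IH[of "\<lambda>j. w (i * m + j)" "C / (1 + e)"] by blast
  have "norm (w (i * m + j)) * (1 + e) ^ Suc r \<le> C"
    using j(2) e by (simp add: field_simps)
  moreover have "i * m + j < n ^ Suc r"
    using le i j m by (simp add: m_def)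
  ultimately show ?case by blast
qed

text \<open>The depth \<open>r\<close> is taken so large that \<open>(1 + e) ^ r\<close> exceeds
  \<open>1 / \<eta>\<close>, and \<open>m\<close> is the number \<open>n ^ r\<close> of leaves. It
  depends on \<open>\<eta>\<close> but not on \<open>w\<close>, so it can be fixed before the pieces
  are built.\<close>

lemma small_summand:
  assumes "\<not> linf_flr TYPE('a)" "0 < \<eta>"
  shows "\<exists>m. \<forall>w :: nat \<Rightarrow> 'a. disjoint_on {..<m} w \<and> norm (\<Sum>k<m. w k) \<le> 1 \<longrightarrow> (\<exists>k<m. norm (w k) \<le> \<eta>)"
proof -
  obtain n e where e: "0 < e" and no_copy: "\<not> linf_copy n e"
    using assms(1) unfolding linf_flr_def linf_copy_def disjoint_on_def by (auto simp: Ball_def)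
  obtain r where r: "1 / \<eta> < (1 + e) ^ r"
    using real_arch_pow[of "1 + e" "1 / \<eta>"] e by auto
  have "\<exists>k<n ^ r. norm (w k) \<le> \<eta>"
    if w: "disjoint_on {..<n ^ r} w" "norm (\<Sum>k<n ^ r. w k) \<le> 1" for w :: "nat \<Rightarrow> 'a"
  proof -
    obtain k where k: "k < n ^ r" "norm (w k) * (1 + e) ^ r \<le> 1"
      using linf_copy_free_tree[OF no_copy e w] by blast
    have "norm (w k) * (1 / \<eta>) \<le> norm (w k) * (1 + e) ^ r"
      using r by (intro mult_left_mono) auto
    also have "\<dots> \<le> 1"
      by (rule k(2))
    finally have "norm (w k) \<le> \<eta>"
      using assms(2) by (simp add: field_simps)
    then show ?thesis
      using k by blast
  qed
  then show ?thesis by blast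
qed

section \<open>Enlarging normalized disjoint families\<close>

text \<open>On \<open>J\<close> the scaling can only enlarge moduli. Members outside
  \<open>J\<close> do not enter the sums, so their norms may be arbitrary; this is the situation of
  a newly added member.\<close>

lemma normalize_disjoint:
  fixes q :: "'i \<Rightarrow> 'a"
  assumes "disjoint_on K q" "finite K" "\<And>i. i \<in> K \<Longrightarrow> q i \<noteq> 0" "J \<subseteq> K"
    and "\<And>i. i \<in> J \<Longrightarrow> norm (q i) \<le> 1"
  shows "\<exists>y :: 'i \<Rightarrow> 'a. normalized_on K y \<and> (\<forall>a. norm (\<Sum>i\<in>J. a i *\<^sub>R q i) \<le> norm (\<Sum>i\<in>J. a i *\<^sub>R y i))"
proof -
  define y where "y i = (1 / norm (q i)) *\<^sub>R q i" for i
  have y: "normalized_on K y"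
    using assms by (auto simp: normalized_on_def disjoint_on_def y_def intro: ldisjoint_scaleR)
  have "labs (q i) \<le> labs (y i)" if "i \<in> J" for i
  proof -
    have "1 *\<^sub>R labs (q i) \<le> \<bar>1 / norm (q i)\<bar> *\<^sub>R labs (q i)"
      using assms(3,4,5) that by (intro scaleR_right_mono) auto
    then show ?thesis
      by (simp add: y_def labs_scaleR)
  qed
  then have "norm (\<Sum>i\<in>J. a i *\<^sub>R q i) \<le> norm (\<Sum>i\<in>J. a i *\<^sub>R y i)" for a
    using assms y disjoint_on_subset[of K _ J] finite_subset[of J K]
    by (intro norm_sum_disjoint_mono[OF bl]) (auto simp: normalized_on_def intro: scaleR_left_mono)
  then show ?thesis
    using y by blast
qed

text \<open>If no new direction is disjoint from the given \<open>x i\<close>, many disjoint elements lie below one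
  \<open>\<bar>x i\<bar>\<close>. One of them can be cut out of \<open>\<bar>x i\<bar>\<close> at small cost.\<close>

lemma extend_normalized_insert:
  fixes x :: "'i \<Rightarrow> 'a"
  assumes no_flr: "\<not> linf_flr TYPE('a)" and J: "finite J" "j \<notin> J" and x: "normalized_on J x"
    and \<epsilon>: "0 < \<epsilon>"
  shows "\<exists>y :: 'i \<Rightarrow> 'a. normalized_on (insert j J) y \<and>
    norm (\<Sum>i\<in>J. a i *\<^sub>R x i) \<le> norm (\<Sum>i\<in>J. a i *\<^sub>R y i) + \<epsilon>"
proof -
  define p where "p i = labs (x i)" for i
  have p0: "0 \<le> p i" "labs (p i) = p i" for i
    by (simp_all add: p_def labs_of_nonneg)
  have p_disj: "disjoint_on J p" and p_norm: "\<And>i. i \<in> J \<Longrightarrow> norm (p i) = 1"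
    using x by (auto simp: p_def normalized_on_def disjoint_on_def ldisjoint_def labs_of_nonneg norm_labs[OF bl])
  have xp: "norm (\<Sum>i\<in>J. a i *\<^sub>R x i) \<le> norm (\<Sum>i\<in>J. a i *\<^sub>R p i)"
    by (rule norm_sum_disjoint_mono[OF bl J(1) order.refl _ p_disj])
      (use x in \<open>simp_all add: normalized_on_def p_def labs_of_nonneg\<close>)
  \<comment> \<open>The bound \<open>1 / 2\<close> keeps the cut member nonzero, since it had norm
    1; the other bound limits the loss \<open>\<bar>a i\<bar> * \<eta>\<close> to
    \<open>\<epsilon>\<close>.\<close>
  define \<eta> where "\<eta> = min (1 / 2) (\<epsilon> / ((\<Sum>i\<in>J. \<bar>a i\<bar>) + 1))"
  have S0: "0 \<le> (\<Sum>i\<in>J. \<bar>a i\<bar>)"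
    by (simp add: sum_nonneg)
  have \<eta>: "0 < \<eta>" "\<eta> \<le> 1 / 2"
    using \<epsilon> S0 unfolding \<eta>_def by (simp add: add_nonneg_pos, intro min.cobounded1)
  have a\<eta>: "\<bar>a i\<bar> * \<eta> \<le> \<epsilon>" if "i \<in> J" for i
  proof -
    have "\<bar>a i\<bar> \<le> (\<Sum>i\<in>J. \<bar>a i\<bar>) + 1"
      using member_le_sum[OF that, of "\<lambda>i. \<bar>a i\<bar>"] J by simp
    then have "\<bar>a i\<bar> * \<eta> \<le> ((\<Sum>i\<in>J. \<bar>a i\<bar>) + 1) * (\<epsilon> / ((\<Sum>i\<in>J. \<bar>a i\<bar>) + 1))"
      using \<eta> S0 by (intro mult_mono) (auto simp: \<eta>_def)
    then show ?thesis
      using S0 by simp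
  qed
  obtain m where m: "\<And>w :: nat \<Rightarrow> 'a. disjoint_on {..<m} w \<Longrightarrow> norm (\<Sum>k<m. w k) \<le> 1 \<Longrightarrow> \<exists>k<m. norm (w k) \<le> \<eta>"
    using small_summand[OF no_flr \<eta>(1)] by blast
  \<comment> \<open>Pigeonhole: if each of more than \<open>card J * m\<close> directions meets some
    member, then some member meets at least \<open>m\<close> of them.\<close>
  define L where "L = Suc (card J * m)"
  obtain y :: "nat \<Rightarrow> 'a" where y: "disjoint_on {..<L} y" "\<And>k. k < L \<Longrightarrow> 0 \<le> y k \<and> y k \<noteq> 0"
    using exists_disjoint_family[OF bl inf_dim, of L] by blast
  consider (free) k where "k < L" "\<And>i. i \<in> J \<Longrightarrow> inf (y k) (p i) = 0"
    | (stuck) "\<And>k. k < L \<Longrightarrow> \<exists>i\<in>J. inf (y k) (p i) \<noteq> 0"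
    by blast
  then show ?thesis
  proof cases
    case free
    define q where "q = p(j := y k)"
    have qJ: "q i = p i" if "i \<in> J" for i
      using that J by (auto simp: q_def)
    have "disjoint_on (insert j J) q"
      unfolding disjoint_on_def
    proof (intro ballI impI)
      fix i l assume il: "i \<in> insert j J" "l \<in> insert j J" "i \<noteq> l"
      have "ldisjoint (y k) (p i)" "ldisjoint (p i) (y k)" if "i \<in> J" for i
        using free y(2)[OF free(1)] p0 that by (simp_all add: ldisjoint_nonneg inf_commute)
      then show "ldisjoint (q i) (q l)"
        using il J p_disj by (auto simp: q_def disjoint_on_def)
    qed
    then obtain z :: "_ \<Rightarrow> 'a" where z: "normalized_on (insert j J) z"
      "\<And>a. norm (\<Sum>i\<in>J. a i *\<^sub>R q i) \<le> norm (\<Sum>i\<in>J. a i *\<^sub>R z i)"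
      using normalize_disjoint[of "insert j J" q J] J p_norm y(2)[OF free(1)] qJ
      by (force simp: q_def)
    have "norm (\<Sum>i\<in>J. a i *\<^sub>R x i) \<le> norm (\<Sum>i\<in>J. a i *\<^sub>R z i) + \<epsilon>"
      using xp z(2)[of a] \<epsilon> qJ by simp
    then show ?thesis
      using z by blast
  next
    case stuck
    have "\<exists>i\<in>J. m \<le> card {k \<in> {..<L}. inf (y k) (p i) \<noteq> 0}"
    proof (rule ccontr)
      assume neg: "\<not> ?thesis"
      have "L = card (\<Union>i\<in>J. {k \<in> {..<L}. inf (y k) (p i) \<noteq> 0})"
      proof -
        have "(\<Union>i\<in>J. {k \<in> {..<L}. inf (y k) (p i) \<noteq> 0}) = {..<L}"
          using stuck by blast
        then show ?thesis by simp
      qed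
      also have "\<dots> \<le> (\<Sum>i\<in>J. card {k \<in> {..<L}. inf (y k) (p i) \<noteq> 0})"
        using J(1) by (rule card_UN_le)
      also have "\<dots> \<le> (\<Sum>i\<in>J. m)"
        using neg by (intro sum_mono) force
      finally show False
        by (simp add: L_def)
    qed
    then obtain i where i: "i \<in> J" "m \<le> card {k \<in> {..<L}. inf (y k) (p i) \<noteq> 0}"
      by blast
    obtain H where H: "H \<subseteq> {k \<in> {..<L}. inf (y k) (p i) \<noteq> 0}" "card H = m" "finite H"
      by (rule obtain_subset_with_card_n[OF i(2)])
    obtain h where h: "bij_betw h {0..<m} H"
      using ex_bij_betw_nat_finite[OF H(3)] H(2) by blast
    have hL: "h k < L" "inf (y (h k)) (p i) \<noteq> 0" if "k < m" for k
    proof -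
      have "h k \<in> H"
        using bij_betwE[OF h] that by simp
      then show "h k < L" "inf (y (h k)) (p i) \<noteq> 0"
        using H(1) by auto
    qed
    define z where "z k = inf (y (h k)) (p i)" for k
    \<comment> \<open>Now \<open>M k *\<^sub>R z k\<close> has norm 2 and cannot lie below
      \<open>p i\<close>, which has norm 1. The excess over \<open>p i\<close> is therefore nonzero
      and can become the new member.\<close>
    define M where "M k = 2 / norm (z k)" for k
    define w where "w k = inf (p i) (M k *\<^sub>R z k)" for k
    have z: "0 \<le> z k" "z k \<le> p i" "z k \<le> y (h k)" "z k \<noteq> 0" if "k < m" for k
      using hL[OF that] y(2)[of "h k"] p0 by (auto simp: z_def)
    have M: "0 < M k" if "k < m" for k
      using z[OF that] by (simp add: M_def)
    have Mz: "0 \<le> M k *\<^sub>R z k" if "k < m" for k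
      using M[OF that] z[OF that] by (intro scaleR_nonneg_nonneg) auto
    have w: "0 \<le> w k" "w k \<le> p i" "w k \<le> M k *\<^sub>R z k" if "k < m" for k
      using Mz[OF that] p0 by (auto simp: w_def)
    have w_disj: "disjoint_on {..<m} w"
      unfolding disjoint_on_def
    proof (intro ballI impI)
      fix k l assume kl: "k \<in> {..<m}" "l \<in> {..<m}" "k \<noteq> l"
      have "h k \<noteq> h l"
        using h kl by (auto simp: bij_betw_def inj_on_def)
      then have "ldisjoint (y (h k)) (y (h l))"
        using y(1) hL kl by (auto simp: disjoint_on_def)
      then have "ldisjoint (z k) (z l)"
        by (rule ldisjoint_mono) (use z kl y(2) hL in \<open>auto simp: labs_of_nonneg\<close>)
      then have "ldisjoint (M k *\<^sub>R z k) (M l *\<^sub>R z l)"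
        by (rule ldisjoint_scaleR)
      then show "ldisjoint (w k) (w l)"
        by (rule ldisjoint_mono) (use w Mz kl in \<open>auto simp: labs_of_nonneg\<close>)
    qed
    have "norm (\<Sum>k<m. w k) \<le> norm (p i)"
      using w w_disj p0 by (intro norm_mono_nonneg[OF bl] sum_nonneg sum_disjoint_le) auto
    then obtain k where k: "k < m" "norm (w k) \<le> \<eta>"
      using m[OF w_disj] p_norm[OF i(1)] by auto
    \<comment> \<open>\<open>s\<close> is \<open>p i\<close> with \<open>w k\<close> removed and
      \<open>v\<close> is the excess of \<open>M k *\<^sub>R z k\<close> over \<open>p i\<close>.
      They are disjoint as positive and negative parts, and both lie below multiples of
      \<open>p i\<close>, hence are disjoint from the other members.\<close>
    define s where "s = sup (p i - M k *\<^sub>R z k) 0"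
    define v where "v = sup (- (p i - M k *\<^sub>R z k)) 0"
    have s0: "0 \<le> s" and v0: "0 \<le> v"
      by (simp_all add: s_def v_def)
    have sw: "p i = s + w k"
    proof -
      have "s = sup (p i) (M k *\<^sub>R z k) - M k *\<^sub>R z k"
        using sup_add_right[of "p i" "- (M k *\<^sub>R z k)" "M k *\<^sub>R z k"] by (simp add: s_def)
      moreover have "w k = p i + M k *\<^sub>R z k - sup (p i) (M k *\<^sub>R z k)"
        using inf_plus_sup[of "p i" "M k *\<^sub>R z k"] by (simp only: w_def eq_diff_eq)
      ultimately show ?thesis by simp
    qed
    have s_le: "s \<le> p i"
      using w[OF k(1)] by (simp add: sw)
    have s_norm: "norm s \<le> 1"
      using norm_mono_nonneg[OF bl s0 s_le] p_norm[OF i(1)] by simp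
    have s_nz: "s \<noteq> 0"
      using k(2) \<eta>(2) p_norm[OF i(1)] sw by auto
    have v_nz: "v \<noteq> 0"
    proof
      assume "v = 0"
      then have "- (p i - M k *\<^sub>R z k) \<le> 0"
        unfolding v_def by (metis sup.cobounded1)
      then have "M k *\<^sub>R z k \<le> p i"
        by simp
      then have "norm (M k *\<^sub>R z k) \<le> norm (p i)"
        using Mz[OF k(1)] by (rule norm_mono_nonneg[OF bl, rotated])
      then show False
        using z[OF k(1)] p_norm[OF i(1)] by (simp add: M_def)
    qed
    have v_le: "v \<le> M k *\<^sub>R p i"
    proof -
      have "M k *\<^sub>R z k - p i \<le> M k *\<^sub>R z k - 0"
        using p0 by (intro diff_left_mono) auto
      then have "v \<le> M k *\<^sub>R z k"
        using Mz[OF k(1)] by (simp add: v_def)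
      also have "\<dots> \<le> M k *\<^sub>R p i"
        using M[OF k(1)] z[OF k(1)] by (intro scaleR_left_mono) auto
      finally show ?thesis .
    qed
    define q where "q = p(i := s, j := v)"
    have ij: "i \<noteq> j"
      using i J by blast
    have sv: "ldisjoint s v"
      using s0 v0 inf_pos_neg_part[of "p i - M k *\<^sub>R z k"]
      by (simp add: ldisjoint_nonneg s_def v_def)
    have far: "ldisjoint (p l) s" "ldisjoint (p l) v" if "l \<in> J" "l \<noteq> i" for l
    proof -
      have d: "ldisjoint (p l) (p i)"
        using p_disj that i by (auto simp: disjoint_on_def)
      show "ldisjoint (p l) s"
        by (rule ldisjoint_mono[OF d]) (use p0 s0 s_le in \<open>auto simp: labs_of_nonneg\<close>)
      have "ldisjoint (1 *\<^sub>R p l) (M k *\<^sub>R p i)"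
        by (rule ldisjoint_scaleR[OF d])
      then show "ldisjoint (p l) v"
        by (rule ldisjoint_mono)
          (use p0 v0 v_le M[OF k(1)] in \<open>auto simp: labs_of_nonneg scaleR_nonneg_nonneg\<close>)
    qed
    have "disjoint_on (insert j J) q"
      unfolding disjoint_on_def
      using sv far p_disj ij i J sv[unfolded ldisjoint_commute[of s]]
        far(1)[unfolded ldisjoint_commute[of _ s]] far(2)[unfolded ldisjoint_commute[of _ v]]
      by (auto simp: q_def disjoint_on_def)
    then obtain y' :: "_ \<Rightarrow> 'a" where y': "normalized_on (insert j J) y'"
      "\<And>a. norm (\<Sum>i\<in>J. a i *\<^sub>R q i) \<le> norm (\<Sum>i\<in>J. a i *\<^sub>R y' i)"
    proof (atomize_elim, rule normalize_disjoint[THEN exE])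
      show "q l \<noteq> 0" if "l \<in> insert j J" for l
        using that s_nz v_nz p_norm[of l] by (auto simp: q_def)
      show "norm (q l) \<le> 1" if "l \<in> J" for l
        using that s_norm p_norm[of l] J by (auto simp: q_def)
    qed (use J in auto)
    \<comment> \<open>Only the term at \<open>i\<close> changes, by
      \<open>a i *\<^sub>R w k\<close>.\<close>
    have "(\<Sum>l\<in>J. a l *\<^sub>R p l) = a i *\<^sub>R p i + (\<Sum>l\<in>J - {i}. a l *\<^sub>R p l)"
      using J i by (simp add: sum.remove)
    also have "(\<Sum>l\<in>J - {i}. a l *\<^sub>R p l) = (\<Sum>l\<in>J - {i}. a l *\<^sub>R q l)"
      using J by (intro sum.cong) (auto simp: q_def)
    also have "a i *\<^sub>R p i + (\<Sum>l\<in>J - {i}. a l *\<^sub>R q l) = (\<Sum>l\<in>J. a l *\<^sub>R q l) + a i *\<^sub>R w k"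
      using J i ij sum.remove[OF J(1) i(1), of "\<lambda>l. a l *\<^sub>R q l"]
      by (simp add: q_def sw scaleR_right_distrib)
    finally have "norm (\<Sum>l\<in>J. a l *\<^sub>R p l) \<le> norm (\<Sum>l\<in>J. a l *\<^sub>R q l) + norm (a i *\<^sub>R w k)"
      by (simp only: norm_triangle_ineq)
    moreover have "norm (a i *\<^sub>R w k) \<le> \<epsilon>"
      using mult_left_mono[OF k(2), of "\<bar>a i\<bar>"] a\<eta>[OF i(1)] by simp
    ultimately have "norm (\<Sum>i\<in>J. a i *\<^sub>R x i) \<le> norm (\<Sum>i\<in>J. a i *\<^sub>R y' i) + \<epsilon>"
      using xp y'(2)[of a] by linarith
    then show ?thesis
      using y' by blast
  qed
qed

lemma extend_normalized:
  fixes x :: "'i \<Rightarrow> 'a"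
  assumes no_flr: "\<not> linf_flr TYPE('a)" and J: "finite J" and x: "normalized_on J x"
    and D: "finite D" "D \<inter> J = {}" and \<epsilon>: "0 < \<epsilon>"
  shows "\<exists>y :: 'i \<Rightarrow> 'a. normalized_on (D \<union> J) y \<and>
    norm (\<Sum>i\<in>J. a i *\<^sub>R x i) \<le> norm (\<Sum>i\<in>J. a i *\<^sub>R y i) + \<epsilon>"
  using D \<epsilon>
proof (induction D arbitrary: \<epsilon>)
  case empty
  then show ?case
    using x by (intro exI[of _ x]) auto
next
  case (insert j D)
  then obtain y :: "_ \<Rightarrow> 'a" where y: "normalized_on (D \<union> J) y"
    "norm (\<Sum>i\<in>J. a i *\<^sub>R x i) \<le> norm (\<Sum>i\<in>J. a i *\<^sub>R y i) + \<epsilon> / 2"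
    using insert.IH[of "\<epsilon> / 2"] insert.prems half_gt_zero by blast
  \<comment> \<open>Padding by zero lets the one-step extension act on \<open>D \<union> J\<close>
    while the indices added earlier contribute nothing to the norm.\<close>
  define a' where "a' i = (if i \<in> J then a i else 0)" for i
  have a': "(\<Sum>i\<in>D \<union> J. a' i *\<^sub>R z i) = (\<Sum>i\<in>J. a i *\<^sub>R z i)" for z :: "'i \<Rightarrow> 'a"
    using insert J by (intro sum.mono_neutral_cong_right) (auto simp: a'_def)
  obtain z :: "_ \<Rightarrow> 'a" where z: "normalized_on (insert j (D \<union> J)) z"
    "norm (\<Sum>i\<in>D \<union> J. a' i *\<^sub>R y i) \<le> norm (\<Sum>i\<in>D \<union> J. a' i *\<^sub>R z i) + \<epsilon> / 2"
    using extend_normalized_insert[OF no_flr _ _ y(1), of j "\<epsilon> / 2" a'] insert J by auto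
  show ?case
  proof (intro exI[of _ z] conjI)
    show "norm (\<Sum>i\<in>J. a i *\<^sub>R x i) \<le> norm (\<Sum>i\<in>J. a i *\<^sub>R z i) + \<epsilon>"
      using z(2) y(2) unfolding a' by linarith
  qed (use z(1) in simp)
qed

text \<open>The family is transported along \<open>\<sigma>\<close> to the image \<open>J\<close>
  and enlarged to all of \<open>{..<m}\<close> with loss \<open>\<epsilon>\<close>; the extra terms
  \<open>a j *\<^sub>R y j\<close> can only raise the norm. As the supremum absorbs every
  \<open>\<epsilon> > 0\<close>, an approximate extension suffices.\<close>

lemma XU_n_reindex:
  assumes no_flr: "\<not> linf_flr TYPE('a)" and \<sigma>: "inj_on \<sigma> {..<n}" "\<sigma> ` {..<n} \<subseteq> {..<m}"
  shows "XU_n TYPE('a) n (\<lambda>i. a (\<sigma> i)) \<le> XU_n TYPE('a) m a"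
proof (rule XU_n_le, rule field_le_epsilon)
  fix x :: "nat \<Rightarrow> 'a" and \<epsilon> :: real
  assume x: "x \<in> Btuples n" and \<epsilon>: "0 < \<epsilon>"
  define J where "J = \<sigma> ` {..<n}"
  define x' where "x' j = x (inv_into {..<n} \<sigma> j)" for j
  have "normalized_on J x'"
    unfolding x'_def J_def
  proof (rule normalized_on_reindex[where \<sigma> = "inv_into {..<n} \<sigma>"])
    show "normalized_on {..<n} x"
      using x by (simp add: Btuples_iff)
  qed (use \<sigma> in \<open>auto simp: inj_on_inv_into inv_into_f_f\<close>)
  then obtain y :: "_ \<Rightarrow> 'a" where y: "normalized_on (({..<m} - J) \<union> J) y"
    "norm (\<Sum>i\<in>J. a i *\<^sub>R x' i) \<le> norm (\<Sum>i\<in>J. a i *\<^sub>R y i) + \<epsilon>"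
    using extend_normalized[OF no_flr _ _ _ _ \<epsilon>, of J x' "{..<m} - J" a] by (auto simp: J_def)
  have J: "({..<m} - J) \<union> J = {..<m}"
    using \<sigma> by (auto simp: J_def)
  have "(\<Sum>i<n. a (\<sigma> i) *\<^sub>R x i) = (\<Sum>j\<in>J. a j *\<^sub>R x' j)"
    unfolding J_def using \<sigma> by (subst sum.reindex) (auto simp: x'_def inv_into_f_f)
  then have "norm (\<Sum>i<n. a (\<sigma> i) *\<^sub>R x i) \<le> norm (\<Sum>j\<in>J. a j *\<^sub>R y j) + \<epsilon>"
    using y by simp
  also have "norm (\<Sum>j\<in>J. a j *\<^sub>R y j) \<le> norm (\<Sum>j<m. a j *\<^sub>R y j)"
    using y J \<sigma> by (intro norm_sum_normalized_mono[OF bl]) (auto simp: J_def)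
  also have "\<dots> \<le> XU_n TYPE('a) m a"
    using y J by (intro le_XU_n) (simp add: Btuples_iff)
  finally show "norm (\<Sum>i<n. a (\<sigma> i) *\<^sub>R x i) \<le> XU_n TYPE('a) m a + \<epsilon>"
    by simp
qed

end

theorem mainTheorem4:
  assumes "banach_lattice_norm TYPE('a::{banach, ordered_real_vector, lattice})"
    and "infinite_dimensional TYPE('a)"
  shows "rearrangement_invariant (XL_set TYPE('a)) (XL_norm TYPE('a))
       \<and> banach_seq_lattice (XU_set TYPE('a)) (XU_norm TYPE('a))
       \<and> (\<not> linf_flr TYPE('a) \<longrightarrow> rearrangement_invariant (XU_set TYPE('a)) (XU_norm TYPE('a)))"
proof -
  interpret inf_dim_banach_lattice "TYPE('a)"
    using assms by unfold_locales
  interpret XU: finite_lattice_norms "XU_n TYPE('a)"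
    by (rule finite_lattice_norms_XU)
  interpret XL: finite_lattice_norms "XL_n TYPE('a)"
    by (rule finite_lattice_norms_XL)
  have XU: "XU.space = XU_set TYPE('a)" "XU.norm_sup = XU_norm TYPE('a)"
    by (auto simp: XU.space_def XU_set_def XU.norm_sup_def XU_norm_def)
  have XL: "XL.space = XL_set TYPE('a)" "XL.norm_sup = XL_norm TYPE('a)"
    by (auto simp: XL.space_def XL_set_def XL.norm_sup_def XL_norm_def)
  show ?thesis
    using XU.banach_seq_lattice_space XU.rearrangement_invariant_space[OF XU_n_reindex]
      XL.rearrangement_invariant_space[OF XL_n_reindex]
    unfolding XU XL by blast
qed

end
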